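(* Let $r\ge 2$ be an integer and set $k:=\lfloor r/2\rfloor$. For every $\epsilon>0$ there is a constant $C>0$, depending only on $r$ and $\epsilon$, such that the following holds for every closed interval $J=[a,b]\subseteq[-r,r]$ and every odd integer $n\ge 2k+1$. Put $[c,d]:=[a/2,b/2]$ if $r$ is even and $[c,d]:=[(a-1)/2,(b-1)/2]$ if $r$ is odd. Let $\mathcal{P}_r(n)$ be the (finite) set of pairs $(S,m)$, where $S\subseteq \mathbb{Z}/n\mathbb{Z}$ satisfies $\#S=r$ and $S=-S$, and $m\in\{0,1,\dots,n-1\}$, and let $\lambda_m(S)\in[-r,r]$ be the corresponding eigenvalue of the Cayley graph of $(\mathbb{Z}/n\mathbb{Z},S)$. Then $$\left|\frac{\#\{(S,m)\in \mathcal{P}_r(n) : \lambda_m(S)\in J\}}{\#\mathcal{P}_r(n)}-\int_c^d \delta^{(k)}(u)\,du\right|\le C\,n^{-1+\epsilon}.$$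
   Context: For odd $n>1$ and $S\subseteq\mathbb{Z}/n\mathbb{Z}$ with $S=-S$, the Cayley graph of $(\mathbb{Z}/n\mathbb{Z},S)$ has vertex set $\mathbb{Z}/n\mathbb{Z}$, with an undirected edge joining $g$ and $h$ if and only if $g-h\in S$ (a loop at each vertex if $0\in S$). Its eigenvalues, indexed by the characters of $\mathbb{Z}/n\mathbb{Z}$ (i.e. counted with multiplicity), are $$\lambda_m(S):=\sum_{s\in S}\exp\left(\frac{2\pi i m s}{n}\right),\qquad m=0,1,\dots,n-1,$$ which are real numbers in $[-r,r]$ where $r=\#S$. Since $n$ is odd, $r$ is odd precisely when $0\in S$. The function $\delta:\mathbb{R}\to\mathbb{R}$ is the normalized arcsine density: $\delta(u)=\frac{1}{\pi\sqrt{1-u^2}}$ for $u\in(-1,1)$ and $\delta(u)=0$ otherwise. Its $k$-fold convolution is $$\delta^{(k)}(u):=\int_{-1}^1\cdots\int_{-1}^1\delta(u_1)\cdots\delta(u_{k-1})\,\delta\Big(u-\sum_{i=1}^{k-1}u_i\Big)\,du_1\cdots du_{k-1},$$ with $\delta^{(1)}=\delta$. *)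

theory Defs
  imports "HOL-Probability.Probability"
begin

text \<open>Elements of \<open>\<int>/n\<int>\<close> are represented by their least nonnegative
  residues, the integers in \<open>{0..<int n}\<close>.\<close>

definition symmetric_residue_set :: "nat \<Rightarrow> int set \<Rightarrow> bool" where
  "symmetric_residue_set n S \<longleftrightarrow>
     S \<subseteq> {0..<int n} \<and> (\<lambda>s. (- s) mod int n) ` S = S"

definition cayley_adjacency :: "nat \<Rightarrow> int set \<Rightarrow> int \<Rightarrow> int \<Rightarrow> complex" where
  "cayley_adjacency n S g h = (if (g - h) mod int n \<in> S then 1 else 0)"

definition cayley_eigenvalue :: "nat \<Rightarrow> int set \<Rightarrow> nat \<Rightarrow> complex" where
  "cayley_eigenvalue n S m =
     (\<Sum>s\<in>S. exp (2 * of_real pi * \<i> * of_nat m * of_int s / of_nat n))"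

definition cayley_pairs :: "nat \<Rightarrow> nat \<Rightarrow> (int set \<times> nat) set" where
  "cayley_pairs r n = {S. symmetric_residue_set n S \<and> card S = r} \<times> {0..<n}"

definition arcsine_density :: "real \<Rightarrow> real" where
  "arcsine_density u =
     (if u \<in> {-1<..<1} then 1 / (pi * sqrt (1 - u\<^sup>2)) else 0)"

text \<open>The integral is over the cube \<open>[-1,1]\<^bsup>k-1\<^esup>\<close>, with coordinates
  indexed by \<open>1, \<dots>, k-1\<close>. For exceptional \<open>u\<close> it diverges (for instance
  \<open>k = 2\<close>, \<open>u = 0\<close>), and the Bochner integral then takes the value \<open>0\<close>; these
  \<open>u\<close> form a null set, which does not affect integrals of the convolution.\<close>

definition arcsine_convolution :: "nat \<Rightarrow> real \<Rightarrow> real" where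
  "arcsine_convolution k u =
     (LINT x : ({1..<k} \<rightarrow>\<^sub>E {-1..1}) | Pi\<^sub>M {1..<k} (\<lambda>_. lborel).
        (\<Prod>i\<in>{1..<k}. arcsine_density (x i)) *
        arcsine_density (u - (\<Sum>i\<in>{1..<k}. x i)))"

lemma arcsine_convolution_1: "arcsine_convolution 1 = arcsine_density"
  by (rule ext)
    (simp add: arcsine_convolution_def set_lebesgue_integral_def PiM_empty
      lebesgue_integral_count_space_finite)

text \<open>For every \<open>m\<close> the character \<open>h \<mapsto> exp (2 \<pi> i m h / n)\<close> is an
  eigenvector of the adjacency matrix with eigenvalue \<open>cayley_eigenvalue n S m\<close>.\<close>

lemma character_mod:
  assumes "n > 0"
  shows "exp (2 * of_real pi * \<i> * of_nat m * of_int (x mod int n) / of_nat n) =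
         exp (2 * of_real pi * \<i> * of_nat m * of_int x / of_nat n)"
proof -
  have "(of_int x :: complex) = of_int (x mod int n) + of_nat n * of_int (x div int n)"
    by (metis mod_mult_div_eq of_int_add of_int_mult of_int_of_nat_eq)
  then have "2 * of_real pi * \<i> * of_nat m * of_int x / of_nat n =
      2 * of_real pi * \<i> * of_nat m * of_int (x mod int n) / of_nat n +
      of_int (2 * (int m * (x div int n))) * (of_real pi * \<i>)"
    using assms by (simp add: field_simps)
  moreover have "exp (of_int (2 * (int m * (x div int n))) * (of_real pi * \<i>)) = 1"
    unfolding exp_eq_1 by (auto intro!: exI[of _ "int m * (x div int n)"])
  ultimately show ?thesis
    by (simp only: exp_add) simp
qed

lemma cayley_eigenvalue_uminus:
  assumes "n > 0" and "symmetric_residue_set n S"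
  shows "(\<Sum>s\<in>S. exp (2 * of_real pi * \<i> * of_nat m * of_int (- s) / of_nat n)) =
         cayley_eigenvalue n S m"
proof -
  have S: "S \<subseteq> {0..<int n}" "(\<lambda>s. (- s) mod int n) ` S = S"
    using assms(2) by (auto simp: symmetric_residue_set_def)
  have "finite S"
    using S(1) finite_subset by blast
  then have inj: "inj_on (\<lambda>s. (- s) mod int n) S"
    using S(2) by (metis eq_card_imp_inj_on)
  have "cayley_eigenvalue n S m =
      (\<Sum>s\<in>(\<lambda>s. (- s) mod int n) ` S.
        exp (2 * of_real pi * \<i> * of_nat m * of_int s / of_nat n))"
    unfolding cayley_eigenvalue_def S(2) ..
  also have "\<dots> = (\<Sum>s\<in>S.
        exp (2 * of_real pi * \<i> * of_nat m * of_int ((- s) mod int n) / of_nat n))"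
    by (subst sum.reindex[OF inj]) (simp only: o_def)
  also have "\<dots> = (\<Sum>s\<in>S. exp (2 * of_real pi * \<i> * of_nat m * of_int (- s) / of_nat n))"
    by (simp only: character_mod[OF assms(1)])
  finally show ?thesis ..
qed

lemma cayley_eigenvalue_eigenvector:
  assumes "n > 0" and "symmetric_residue_set n S"
  shows "(\<Sum>h\<in>{0..<int n}. cayley_adjacency n S g h *
            exp (2 * of_real pi * \<i> * of_nat m * of_int h / of_nat n)) =
         cayley_eigenvalue n S m *
            exp (2 * of_real pi * \<i> * of_nat m * of_int g / of_nat n)"
proof -
  have S: "S \<subseteq> {0..<int n}"
    using assms(2) by (auto simp: symmetric_residue_set_def)
  let ?e = "\<lambda>x::int. exp (2 * of_real pi * \<i> * of_nat m * of_int x / of_nat n) :: complex"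
  have "(\<Sum>h\<in>{0..<int n}. cayley_adjacency n S g h * ?e h) =
      (\<Sum>h\<in>{h\<in>{0..<int n}. (g - h) mod int n \<in> S}. ?e h)"
    by (subst sum.inter_filter) (auto simp: cayley_adjacency_def intro!: sum.cong)
  also have "\<dots> = (\<Sum>s\<in>S. ?e ((g - s) mod int n))"
    using S assms(1)
    by (intro sum.reindex_bij_witness[where i = "\<lambda>s. (g - s) mod int n"
          and j = "\<lambda>h. (g - h) mod int n"])
      (auto simp: mod_diff_right_eq subset_iff)
  also have "\<dots> = (\<Sum>s\<in>S. ?e (- s) * ?e g)"
    by (simp only: character_mod[OF assms(1)])
      (simp add: exp_add[symmetric] diff_divide_distrib algebra_simps)
  also have "\<dots> = cayley_eigenvalue n S m * ?e g"
    by (simp only: sum_distrib_right[symmetric] cayley_eigenvalue_uminus[OF assms])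
  finally show ?thesis .
qed

lemma cayley_eigenvalue_real:
  assumes "n > 0" and "symmetric_residue_set n S"
  shows "cayley_eigenvalue n S m \<in> \<real>"
proof -
  have "cnj (cayley_eigenvalue n S m) =
      (\<Sum>s\<in>S. exp (2 * of_real pi * \<i> * of_nat m * of_int (- s) / of_nat n))"
    by (simp add: cayley_eigenvalue_def exp_cnj)
  then show ?thesis
    using cayley_eigenvalue_uminus[OF assms] by (simp add: Reals_cnj_iff)
qed

end

theory Submission
  imports Defs
begin

text \<open>Write \<open>n = 2 h + 1\<close>. A symmetric set is determined by its part \<open>T \<subseteq> {1..h}\<close> of size
  \<open>k\<close>, and its eigenvalue is \<open>2 (\<Sum>t\<in>T. cos (2 \<pi> m t / n))\<close>, plus \<open>1\<close> if \<open>r\<close> is odd. For fixed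
  \<open>m\<close> with \<open>g = gcd m n\<close>, the points \<open>cos (2 \<pi> m t / n)\<close> come from \<open>n / g\<close> equally spaced
  angles, so the proportion of them in any interval is the arcsine measure of the interval up to
  \<open>O(g / n)\<close>. Replacing the \<open>k\<close> summands one at a time by arcsine variables preserves this error
  up to a factor \<open>k\<close>, and restricting to distinct summands costs \<open>O(k\<^sup>2 / n)\<close>. The average of
  \<open>gcd m n\<close> over \<open>m\<close> is at most the number of divisors of \<open>n\<close>, which is \<open>O(n powr \<epsilon>)\<close>.\<close>

subsection \<open>The divisor bound\<close>

text \<open>The limiting density is unbounded for one and for two summands, and the finite point
  sets are highly degenerate for some m. The argument therefore compares only measures of intervals,
  with an error uniform over all intervals, and needs no regularity of the density. This kind of
  estimate survives adding a summand, because a translate of an interval is an interval; the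
  identification of the law with \<open>arcsine_convolution\<close> is a separate matter. No m is
  discarded: for m = 0 all cosines equal 1 and the bound O(gcd m n / n) is trivial, but such m are
  too rare to spoil the average. The loss of \<epsilon> in the exponent comes from the divisor bound
  alone; all other estimates lose only factors depending on k.\<close>

definition divisor_count :: "nat \<Rightarrow> nat" where
  "divisor_count n = card {d. d dvd n}"

lemma finite_divisors: "n > 0 \<Longrightarrow> finite {d. d dvd (n::nat)}"
  by (rule finite_subset[of _ "{..n}"]) (auto dest: dvd_imp_le)

lemma divisor_count_pos: "n > 0 \<Longrightarrow> divisor_count n > 0"
  unfolding divisor_count_def using finite_divisors[of n] by (auto simp: card_gt_0_iff)

lemma divisor_count_mult_le:
  assumes "a > 0" "b > 0"
  shows "divisor_count (a * b) \<le> divisor_count a * divisor_count b"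
proof -
  have "{d. d dvd a * b} \<subseteq> (\<lambda>(x, y). x * y) ` ({d. d dvd a} \<times> {d. d dvd b})"
    by (auto simp: image_iff dest: division_decomp)
  then have "card {d. d dvd a * b} \<le> card ({d. d dvd a} \<times> {d. d dvd b})"
    using assms by (intro surj_card_le) (auto simp: finite_divisors)
  then show ?thesis
    by (simp add: divisor_count_def card_cartesian_product)
qed

lemma divisor_count_prime_power:
  assumes "prime p"
  shows "divisor_count (p ^ a) \<le> a + 1"
proof -
  have "{d. d dvd p ^ a} \<subseteq> (\<lambda>i. p ^ i) ` {..a}"
    using assms by (auto simp: divides_primepow_nat)
  then have "card {d. d dvd p ^ a} \<le> card {..a}"
    by (intro surj_card_le) auto
  then show ?thesis by (simp add: divisor_count_def)
qed

lemma divisor_count_prod_le: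
  assumes "finite A" "\<And>x. x \<in> A \<Longrightarrow> f x > 0"
  shows "divisor_count (\<Prod>x\<in>A. f x) \<le> (\<Prod>x\<in>A. divisor_count (f x))"
  using assms
proof (induction A)
  case empty
  have "{d. d dvd (1::nat)} = {1}" by auto
  then show ?case by (simp add: divisor_count_def)
next
  case (insert x A)
  have "divisor_count (\<Prod>x\<in>insert x A. f x) \<le> divisor_count (f x) * divisor_count (\<Prod>x\<in>A. f x)"
    using insert by (simp) (intro divisor_count_mult_le, auto intro: prod_pos)
  also have "\<dots> \<le> divisor_count (f x) * (\<Prod>x\<in>A. divisor_count (f x))"
    using insert by (intro mult_left_mono) auto
  finally show ?case using insert by simp
qed

text \<open>Primes \<open>p\<close> with \<open>p powr \<epsilon> \<ge> 2\<close> contribute a factor at most \<open>1\<close> to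
  \<open>divisor_count n / n powr \<epsilon>\<close>; each of the finitely many others contributes a bounded one.\<close>

lemma divisor_count_bound:
  fixes \<epsilon> :: real
  assumes "\<epsilon> > 0"
  obtains C where "C > 0" "\<And>n. n > 0 \<Longrightarrow> real (divisor_count n) \<le> C * real n powr \<epsilon>"
proof -
  \<comment> \<open>\<open>K\<close> is a threshold from which on p powr \<epsilon> is at least 2.
    \<open>B\<close> is chosen so that expanding B (1 + a \<epsilon> ln 2) yields both the 1 and the
    a of a + 1.\<close>
  define K where "K = nat \<lceil>2 powr (1 / \<epsilon>)\<rceil>"
  define B where "B = 1 + 1 / (\<epsilon> * ln 2)"
  have B: "B \<ge> 1" using assms by (simp add: B_def)
  have factor: "real (a + 1) \<le> (if p < K then B else 1) * (real p ^ a) powr \<epsilon>"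
    if "prime p" for p a :: nat
  proof -
    have p2: "p \<ge> 2" using that prime_ge_2_nat by blast
    have pa: "(real p ^ a) powr \<epsilon> = (real p powr \<epsilon>) ^ a"
      using p2 by (simp add: powr_realpow[symmetric] powr_powr mult.commute)
    show ?thesis
    proof (cases "p < K")
      case True
      have "1 + real a * (\<epsilon> * ln 2) \<le> exp (real a * (\<epsilon> * ln 2))" by (rule exp_ge_add_one_self)
      also have "\<dots> = (2 powr \<epsilon>) ^ a" by (simp add: powr_def exp_of_nat_mult)
      also have "\<dots> \<le> (real p powr \<epsilon>) ^ a"
        using p2 assms by (intro power_mono powr_mono2) auto
      finally have *: "1 + real a * (\<epsilon> * ln 2) \<le> (real p powr \<epsilon>) ^ a" .
      have pos: "\<epsilon> * ln 2 > 0" using assms by simp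
      have "real (a + 1) \<le> B * (1 + real a * (\<epsilon> * ln 2))"
        using pos assms unfolding B_def by (auto simp: field_simps)
      also have "\<dots> \<le> B * (real p powr \<epsilon>) ^ a"
        using * B by (intro mult_left_mono) auto
      finally show ?thesis using True pa by simp
    next
      case False
      have "2 powr (1 / \<epsilon>) \<le> real p"
        using False unfolding K_def by linarith
      then have "(2 powr (1 / \<epsilon>)) powr \<epsilon> \<le> real p powr \<epsilon>"
        using assms by (intro powr_mono2) auto
      then have "2 \<le> real p powr \<epsilon>"
        using assms by (simp add: powr_powr)
      then have "2 ^ a \<le> (real p powr \<epsilon>) ^ a"
        by (intro power_mono) auto
      moreover have "a + 1 \<le> 2 ^ a" by (induction a) auto
      then have "real (a + 1) \<le> 2 ^ a" using of_nat_mono by fastforce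
      ultimately show ?thesis using False pa by simp
    qed
  qed
  show thesis
  proof (rule that[of "B ^ K"])
    show "B ^ K > 0" using B by simp
    fix n :: nat assume n: "n > 0"
    let ?P = "prime_factors n" and ?m = "\<lambda>p. multiplicity p n"
    have n_eq: "n = (\<Prod>p\<in>?P. p ^ ?m p)"
      using n by (simp add: prod_prime_factors)
    have "real (divisor_count n) \<le> real (\<Prod>p\<in>?P. divisor_count (p ^ ?m p))"
      by (subst n_eq, rule of_nat_mono, rule divisor_count_prod_le)
        (auto dest: in_prime_factors_imp_prime simp: prime_gt_0_nat)
    also have "\<dots> = (\<Prod>p\<in>?P. real (divisor_count (p ^ ?m p)))" by simp
    also have "\<dots> \<le> (\<Prod>p\<in>?P. (if p < K then B else 1) * (real p ^ ?m p) powr \<epsilon>)"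
    proof (intro prod_mono conjI)
      fix p assume "p \<in> ?P"
      then have p: "prime p" by (rule in_prime_factors_imp_prime)
      show "real (divisor_count (p ^ ?m p)) \<le> (if p < K then B else 1) * (real p ^ ?m p) powr \<epsilon>"
        using divisor_count_prime_power[OF p, of "?m p"] factor[OF p, of "?m p"] by linarith
    qed simp
    also have "\<dots> = (\<Prod>p\<in>?P. if p < K then B else 1) * (\<Prod>p\<in>?P. (real p ^ ?m p) powr \<epsilon>)"
      by (rule prod.distrib)
    also have "(\<Prod>p\<in>?P. (real p ^ ?m p) powr \<epsilon>) = real n powr \<epsilon>"
      by (subst (3) n_eq) (simp add: prod_powr_distrib)
    also have "(\<Prod>p\<in>?P. if p < K then B else 1) = B ^ card {p\<in>?P. p < K}"
      by (simp add: prod.If_cases Int_def)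
    \<comment> \<open>At most \<open>K\<close> prime factors lie below \<open>K\<close>, whatever n
      is; since \<open>B\<close> is at least 1, their contribution is absorbed in the constant
      \<open>B ^ K\<close>.\<close>
    also have "B ^ card {p\<in>?P. p < K} * real n powr \<epsilon> \<le> B ^ K * real n powr \<epsilon>"
    proof (intro mult_right_mono power_increasing)
      have "card {p\<in>?P. p < K} \<le> card {..<K}" by (rule card_mono) auto
      then show "card {p\<in>?P. p < K} \<le> K" by simp
    qed (use B in auto)
    finally show "real (divisor_count n) \<le> B ^ K * real n powr \<epsilon>" .
  qed
qed

text \<open>The m whose gcd with n is g are multiples of g below n. There are at most n / g of them,
  so each divisor g accounts for at most n in the sum.\<close>

lemma sum_gcd_le:
  assumes "n > 0"
  shows "(\<Sum>m<n. gcd m n) \<le> n * divisor_count n"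
proof -
  have "(\<Sum>m<n. gcd m n) = (\<Sum>g\<in>{d. d dvd n}. \<Sum>m\<in>{m\<in>{..<n}. gcd m n = g}. gcd m n)"
    by (subst sum.group) (use assms in \<open>auto simp: finite_divisors\<close>)
  also have "\<dots> \<le> (\<Sum>g\<in>{d. d dvd n}. n)"
  proof (rule sum_mono)
    fix g assume g: "g \<in> {d. d dvd n}"
    have "{m\<in>{..<n}. gcd m n = g} \<subseteq> (\<lambda>q. g * q) ` {..<n div g}"
    proof
      fix m assume m: "m \<in> {m\<in>{..<n}. gcd m n = g}"
      then have "m = g * (m div g)" "m < n" by auto
      moreover have "m div g < n div g"
        using m g by (metis calculation(1) calculation(2) dvd_mult_div_cancel mem_Collect_eq
          mult_less_cancel1)
      ultimately show "m \<in> (\<lambda>q. g * q) ` {..<n div g}" by blast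
    qed
    then have "card {m\<in>{..<n}. gcd m n = g} \<le> n div g"
      using surj_card_le[of "{..<n div g}"] by fastforce
    then have "card {m\<in>{..<n}. gcd m n = g} * g \<le> n div g * g" by (rule mult_right_mono) simp
    also have "\<dots> = n" using g by simp
    finally show "(\<Sum>m\<in>{m\<in>{..<n}. gcd m n = g}. gcd m n) \<le> n" by simp
  qed
  also have "\<dots> = n * divisor_count n" by (simp add: divisor_count_def)
  finally show ?thesis .
qed

subsection \<open>The arcsine law\<close>

abbreviation arcsine_law :: "real measure" where
  "arcsine_law \<equiv> density lborel (\<lambda>u. ennreal (arcsine_density u))"

lemma arcsine_density_nonneg: "arcsine_density u \<ge> 0"
proof (cases "u \<in> {-1<..<1}")
  case True
  then have "u\<^sup>2 \<le> 1" by (auto simp: abs_square_le_1)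
  then show ?thesis by (simp add: arcsine_density_def)
qed (auto simp: arcsine_density_def)

lemma borel_measurable_arcsine_density [measurable]: "arcsine_density \<in> borel_measurable borel"
  unfolding arcsine_density_def[abs_def] by measurable

text \<open>\<open>arccos\<close> is meaningful only on [-1, 1]. Clamping extends the distribution
  function by 0 to the left and by 1 to the right, so interval estimates hold for arbitrary real
  endpoints.\<close>

definition clamp_unit :: "real \<Rightarrow> real" where "clamp_unit x = max (- 1) (min 1 x)"

text \<open>Distribution function of cos \<theta> for \<theta> uniform on [0, pi], where cos
  \<theta> \<le> x means \<theta> \<ge> arccos x.\<close>

definition arcsine_cdf :: "real \<Rightarrow> real" where
  "arcsine_cdf x = 1 - arccos (clamp_unit x) / pi"

lemma emeasure_arcsine_law_Icc_unit:
  assumes "- 1 \<le> c" "c \<le> d" "d \<le> 1"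
  shows "emeasure arcsine_law {c..d} = ennreal (arcsine_cdf d - arcsine_cdf c)"
proof -
  have "(arcsine_density has_integral (- arccos d / pi - - arccos c / pi)) {c..d}"
  \<comment> \<open>At -1 and 1 the antiderivative is continuous but not differentiable, so
    derivatives are taken at interior points only.\<close>
  proof (rule fundamental_theorem_of_calculus_interior)
    show "continuous_on {c..d} (\<lambda>x. - arccos x / pi)"
      using assms by (intro continuous_intros) (auto)
    fix x assume x: "x \<in> {c<..<d}"
    have "((\<lambda>x. - arccos x / pi) has_real_derivative arcsine_density x) (at x)"
      using x assms by (auto intro!: derivative_eq_intros simp: arcsine_density_def field_simps)
    then show "((\<lambda>x. - arccos x / pi) has_vector_derivative arcsine_density x) (at x)"
      by (simp add: has_real_derivative_iff_has_vector_derivative)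
  qed (use assms in auto)
  then have "(arcsine_density has_integral (arcsine_cdf d - arcsine_cdf c)) {c..d}"
    using assms by (simp add: arcsine_cdf_def clamp_unit_def)
  then have "((\<lambda>x. arcsine_density x * indicator {c..d} x) has_integral
      (arcsine_cdf d - arcsine_cdf c)) UNIV"
    by (subst (asm) has_integral_restrict_UNIV[symmetric])
      (simp add: indicator_def of_bool_def if_distrib[of "\<lambda>x. _ * x"] cong: if_cong)
  then have "(\<integral>\<^sup>+x. arcsine_density x * indicator {c..d} x \<partial>lborel) = arcsine_cdf d - arcsine_cdf c"
    by (intro nn_integral_has_integral_lborel) (auto simp: arcsine_density_nonneg)
  then show ?thesis
    by (subst emeasure_density)
      (auto simp: ennreal_mult' ennreal_indicator arcsine_density_nonneg mult.commute)
qed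

text \<open>All mass lies in the open interval (-1, 1), and inside it the original and the clamped
  interval agree. The detour through the open interval is needed because the closed ones can differ
  even within [-1, 1]: an interval to the right of 1 is clamped to the point 1.\<close>

lemma emeasure_arcsine_law_Icc:
  assumes "c \<le> d"
  shows "emeasure arcsine_law {c..d} = ennreal (arcsine_cdf d - arcsine_cdf c)"
proof -
  have "emeasure arcsine_law {c..d} = emeasure arcsine_law ({c..d} \<inter> {-1<..<1})"
    by (auto simp: emeasure_density arcsine_density_def intro!: nn_integral_cong
      split: split_indicator)
  also have "\<dots> = emeasure arcsine_law ({clamp_unit c..clamp_unit d} \<inter> {-1<..<1})"
    using assms by (intro arg_cong[where f = "emeasure arcsine_law"]) (auto simp: clamp_unit_def)
  also have "\<dots> = emeasure arcsine_law {clamp_unit c..clamp_unit d}"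
    by (auto simp: emeasure_density arcsine_density_def intro!: nn_integral_cong
      split: split_indicator)
  also have "\<dots> = ennreal (arcsine_cdf (clamp_unit d) - arcsine_cdf (clamp_unit c))"
    using assms by (intro emeasure_arcsine_law_Icc_unit) (auto simp: clamp_unit_def)
  also have "\<dots> = ennreal (arcsine_cdf d - arcsine_cdf c)"
    by (simp add: arcsine_cdf_def clamp_unit_def)
  finally show ?thesis .
qed

lemma arcsine_cdf_mono: "c \<le> d \<Longrightarrow> arcsine_cdf c \<le> arcsine_cdf d"
  by (auto simp: arcsine_cdf_def clamp_unit_def intro!: divide_right_mono arccos_le_arccos)

lemma measure_arcsine_law_Icc:
  "c \<le> d \<Longrightarrow> measure arcsine_law {c..d} = arcsine_cdf d - arcsine_cdf c"
  using emeasure_arcsine_law_Icc[of c d] arcsine_cdf_mono[of c d]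
  by (simp add: measure_def)

lemma prob_space_arcsine_law: "prob_space arcsine_law"
proof
  have "emeasure arcsine_law (space arcsine_law) = emeasure arcsine_law {-1..1}"
    by (auto simp: emeasure_density arcsine_density_def intro!: nn_integral_cong
      split: split_indicator)
  also have "\<dots> = 1" by (simp add: emeasure_arcsine_law_Icc arcsine_cdf_def clamp_unit_def)
  finally show "emeasure arcsine_law (space arcsine_law) = 1" .
qed

subsection \<open>Cosines of equally spaced angles\<close>

lemma card_nat_interval_closed:
  fixes u v :: real
  assumes "0 \<le> u" "u \<le> v"
  shows "\<bar>real (card {t. u \<le> real t \<and> real t \<le> v}) - (v - u)\<bar> \<le> 1"
proof -
  have "{t. u \<le> real t \<and> real t \<le> v} = {nat \<lceil>u\<rceil>..nat \<lfloor>v\<rfloor>}"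
    using assms by (auto simp: nat_le_iff ceiling_le_iff le_nat_iff le_floor_iff)
  \<comment> \<open>This makes the truncated subtraction in the cardinality exact even when no
    integer lies between u and v.\<close>
  moreover have "nat \<lceil>u\<rceil> \<le> nat \<lfloor>v\<rfloor> + 1" using assms by linarith
  ultimately have "real (card {t. u \<le> real t \<and> real t \<le> v}) = real (nat \<lfloor>v\<rfloor>) + 1 - real (nat \<lceil>u\<rceil>)"
    by simp
  then show ?thesis using assms by linarith
qed

lemma card_nat_interval_open:
  fixes u v :: real
  assumes "0 \<le> u" "u \<le> v"
  shows "\<bar>real (card {t. u < real t \<and> real t < v}) - (v - u)\<bar> \<le> 1"
proof -
  have "{t. u < real t \<and> real t < v} = {nat \<lfloor>u\<rfloor> + 1..<nat \<lceil>v\<rceil>}"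
    using assms by (auto simp: less_ceiling_iff zless_nat_conj nat_less_iff) linarith+
  then have "card {t. u < real t \<and> real t < v} = nat \<lceil>v\<rceil> - (nat \<lfloor>u\<rfloor> + 1)" by simp
  then show ?thesis using assms by linarith
qed

text \<open>Cosine decreases on [0, pi], and \<theta> -> 2 pi - \<theta> brings the other half
  period there. The solutions form one arc centred at pi, so counting angles reduces to counting
  integers in one interval.\<close>

lemma cos_le_iff:
  assumes "0 \<le> \<theta>" "\<theta> < 2 * pi" "- 1 \<le> x" "x \<le> 1"
  shows "cos \<theta> \<le> x \<longleftrightarrow> arccos x \<le> \<theta> \<and> \<theta> \<le> 2 * pi - arccos x"
    and "cos \<theta> < x \<longleftrightarrow> arccos x < \<theta> \<and> \<theta> < 2 * pi - arccos x"
proof -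
  define y where "y = arccos x"
  have y: "0 \<le> y" "y \<le> pi" "cos y = x"
    using assms by (auto simp: y_def arccos_lbound arccos_ubound)
  have "(cos \<theta> \<le> x \<longleftrightarrow> y \<le> \<theta> \<and> \<theta> \<le> 2 * pi - y) \<and> (cos \<theta> < x \<longleftrightarrow> y < \<theta> \<and> \<theta> < 2 * pi - y)"
  proof (cases "\<theta> \<le> pi")
    case True
    then show ?thesis
      using y assms cos_mono_le_eq[of \<theta> y] cos_mono_less_eq[of \<theta> y] by auto
  next
    case False
    define \<psi> where "\<psi> = 2 * pi - \<theta>"
    have "cos \<theta> = cos \<psi>" "0 \<le> \<psi>" "\<psi> \<le> pi"
      using False assms by (simp_all add: \<psi>_def cos_diff)
    moreover from this have "cos \<psi> \<le> x \<longleftrightarrow> y \<le> \<psi>" "cos \<psi> < x \<longleftrightarrow> y < \<psi>"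
      using y cos_mono_le_eq[of \<psi> y] cos_mono_less_eq[of \<psi> y] by auto
    moreover have "y < \<theta>" using False y by simp
    ultimately show ?thesis unfolding \<psi>_def by auto
  qed
  then show "cos \<theta> \<le> x \<longleftrightarrow> arccos x \<le> \<theta> \<and> \<theta> \<le> 2 * pi - arccos x"
    and "cos \<theta> < x \<longleftrightarrow> arccos x < \<theta> \<and> \<theta> < 2 * pi - arccos x"
    by (simp_all add: y_def)
qed

text \<open>Weak and strict counts share a main term because the arcsine law has no atoms. Both are
  needed: the count for {c..d} is the weak count at d minus the strict count at c, each with error
  1.\<close>

lemma card_cos_le:
  assumes "N > 0"
  shows "\<bar>real (card {t. t < N \<and> cos (2 * pi * real t / real N) \<le> x}) - N * arcsine_cdf x\<bar> \<le> 1"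
    and "\<bar>real (card {t. t < N \<and> cos (2 * pi * real t / real N) < x}) - N * arcsine_cdf x\<bar> \<le> 1"
proof -
  let ?\<theta> = "\<lambda>t. 2 * pi * real t / real N"
  let ?A = "{t. t < N \<and> cos (?\<theta> t) \<le> x}" and ?B = "{t. t < N \<and> cos (?\<theta> t) < x}"
  have "\<bar>real (card ?A) - N * arcsine_cdf x\<bar> \<le> 1 \<and> \<bar>real (card ?B) - N * arcsine_cdf x\<bar> \<le> 1"
  proof (cases "- 1 \<le> x \<and> x \<le> 1")
    case False
    then consider "x < - 1" | "x > 1" by linarith
    then show ?thesis
    proof cases
      case 1
      then have "cos (?\<theta> t) > x" for t using cos_ge_minus_one[of "?\<theta> t"] by linarith
      then have "?A = {}" "?B = {}" by (auto simp: not_le not_less less_imp_le)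
      then show ?thesis using 1 by (simp only:) (simp add: arcsine_cdf_def clamp_unit_def)
    next
      case 2
      then have "cos (?\<theta> t) < x" for t using cos_le_one[of "?\<theta> t"] by linarith
      then have "?A = {..<N}" "?B = {..<N}" by (auto simp: less_imp_le)
      then show ?thesis using 2 by (simp only:) (simp add: arcsine_cdf_def clamp_unit_def)
    qed
  next
    case True
    \<comment> \<open>In units of a full turn, the condition on t is to lie between N \<alpha> and N
      (1 - \<alpha>); the length N (1 - 2 \<alpha>) of this interval is exactly the main
      term.\<close>
    define \<alpha> where "\<alpha> = arccos x / (2 * pi)"
    have \<alpha>: "0 \<le> \<alpha>" "\<alpha> \<le> 1 / 2" "arccos x = 2 * pi * \<alpha>"
      using True arccos_lbound[of x] arccos_ubound[of x] by (auto simp: \<alpha>_def field_simps)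
    have cdf: "N * arcsine_cdf x = N * (1 - \<alpha>) - N * \<alpha>"
      using True \<alpha> by (simp add: arcsine_cdf_def clamp_unit_def algebra_simps)
    have cosle: "(cos (?\<theta> t) \<le> x \<longleftrightarrow> N * \<alpha> \<le> t \<and> t \<le> N * (1 - \<alpha>)) \<and>
        (cos (?\<theta> t) < x \<longleftrightarrow> N * \<alpha> < t \<and> t < N * (1 - \<alpha>))" if "t < N" for t
    proof -
      have "?\<theta> t < 2 * pi" using that by (simp add: field_simps)
      moreover have "2 * pi * \<alpha> \<le> ?\<theta> t \<longleftrightarrow> N * \<alpha> \<le> t" "2 * pi * \<alpha> < ?\<theta> t \<longleftrightarrow> N * \<alpha> < t"
        using assms by (simp_all add: field_simps)
      moreover have "?\<theta> t \<le> 2 * pi - 2 * pi * \<alpha> \<longleftrightarrow> t \<le> N * (1 - \<alpha>)"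
          "?\<theta> t < 2 * pi - 2 * pi * \<alpha> \<longleftrightarrow> t < N * (1 - \<alpha>)"
      proof -
        have *: "2 * pi - 2 * pi * \<alpha> = 2 * pi * (1 - \<alpha>)" "?\<theta> t = 2 * pi * (t / N)"
          by (simp_all add: algebra_simps)
        moreover have "t / N \<le> 1 - \<alpha> \<longleftrightarrow> t \<le> N * (1 - \<alpha>)" "t / N < 1 - \<alpha> \<longleftrightarrow> t < N * (1 - \<alpha>)"
          using assms by (simp_all add: pos_divide_le_eq pos_divide_less_eq mult.commute)
        moreover have "2 * pi * u \<le> 2 * pi * v \<longleftrightarrow> u \<le> v" "2 * pi * u < 2 * pi * v \<longleftrightarrow> u < v" for u v
          by simp_all
        ultimately show "?\<theta> t \<le> 2 * pi - 2 * pi * \<alpha> \<longleftrightarrow> t \<le> N * (1 - \<alpha>)"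
          "?\<theta> t < 2 * pi - 2 * pi * \<alpha> \<longleftrightarrow> t < N * (1 - \<alpha>)"
          unfolding * by (simp_all only:)
      qed
      moreover have "0 \<le> ?\<theta> t" by simp
      ultimately show ?thesis
        using cos_le_iff[of "?\<theta> t" x] True unfolding \<alpha>(3) by blast
    qed
    have le: "0 \<le> N * \<alpha>" "N * \<alpha> \<le> N * (1 - \<alpha>)" using \<alpha> by (auto intro!: mult_left_mono)
    have "?B = {t. N * \<alpha> < real t \<and> real t < N * (1 - \<alpha>)}"
    proof -
      have "t < N" if "real t < N * (1 - \<alpha>)" for t
      proof -
        have "N * (1 - \<alpha>) \<le> real N" using \<alpha> by (simp add: mult_left_le)
        then show ?thesis using that by linarith
      qed
      then show ?thesis using cosle by blast
    qed
    then have B: "\<bar>real (card ?B) - N * arcsine_cdf x\<bar> \<le> 1"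
      using card_nat_interval_open[OF le] cdf by (simp only:)
    have A: "\<bar>real (card ?A) - N * arcsine_cdf x\<bar> \<le> 1"
    \<comment> \<open>For \<alpha> = 0 the closed interval is [0, N] and contains t = N, which is
      out of range; in this case every angle qualifies.\<close>
    proof (cases "\<alpha> = 0")
      case True
      then have "?A = {..<N}" using cosle by auto
      moreover have "N * arcsine_cdf x = N" using cdf True by simp
      ultimately show ?thesis by (simp only:) simp
    next
      case False
      have "t < N" if "real t \<le> N * (1 - \<alpha>)" for t
      proof -
        have "N * (1 - \<alpha>) < real N" using \<alpha> False assms by simp
        then show ?thesis using that by linarith
      qed
      then have "?A = {t. N * \<alpha> \<le> real t \<and> real t \<le> N * (1 - \<alpha>)}" using cosle by blast
      then show ?thesis using card_nat_interval_closed[OF le] cdf by (simp only:)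
    qed
    show ?thesis using A B by blast
  qed
  then show "\<bar>real (card ?A) - N * arcsine_cdf x\<bar> \<le> 1" "\<bar>real (card ?B) - N * arcsine_cdf x\<bar> \<le> 1"
    by auto
qed

lemma card_cos_Icc:
  assumes "N > 0" "c \<le> d"
  shows "\<bar>real (card {t. t < N \<and> cos (2 * pi * real t / real N) \<in> {c..d}})
    - N * measure arcsine_law {c..d}\<bar> \<le> 2"
proof -
  let ?\<theta> = "\<lambda>t. 2 * pi * real t / real N"
  have eq: "{t. t < N \<and> cos (?\<theta> t) \<in> {c..d}} =
      {t. t < N \<and> cos (?\<theta> t) \<le> d} - {t. t < N \<and> cos (?\<theta> t) < c}" by auto
  have "card {t. t < N \<and> cos (?\<theta> t) \<in> {c..d}} =
      card {t. t < N \<and> cos (?\<theta> t) \<le> d} - card {t. t < N \<and> cos (?\<theta> t) < c}"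
    unfolding eq using assms(2) by (intro card_Diff_subset) auto
  moreover have "card {t. t < N \<and> cos (?\<theta> t) < c} \<le> card {t. t < N \<and> cos (?\<theta> t) \<le> d}"
    using assms by (intro card_mono) auto
  ultimately have "real (card {t. t < N \<and> cos (?\<theta> t) \<in> {c..d}}) =
      card {t. t < N \<and> cos (?\<theta> t) \<le> d} - real (card {t. t < N \<and> cos (?\<theta> t) < c})"
    by simp
  moreover have "N * measure arcsine_law {c..d} = N * arcsine_cdf d - N * arcsine_cdf c"
    using assms by (simp add: measure_arcsine_law_Icc algebra_simps)
  ultimately show ?thesis
    using card_cos_le(1)[OF assms(1), of d] card_cos_le(2)[OF assms(1), of c] by linarith
qed

text \<open>The range of s consists of g blocks of length N, and on each block s -> m s mod N runs
  through every residue once, m being invertible modulo N.\<close>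

lemma card_coprime_mult_mod:
  fixes N g m :: nat
  assumes "N > 0" "coprime m N"
  shows "card {s. s < g * N \<and> R (m * s mod N)} = g * card {t. t < N \<and> R t}"
proof -
  let ?f = "\<lambda>s. of_bool (R (m * s mod N)) :: nat"
  have inj: "inj_on (\<lambda>t. m * t mod N) {..<N}"
  proof (rule linorder_inj_onI)
    fix s t assume st: "s < t" "s \<in> {..<N}" "t \<in> {..<N}"
    show "m * s mod N \<noteq> m * t mod N"
    proof
      assume "m * s mod N = m * t mod N"
      then have "N dvd m * t - m * s"
        using st by (subst mod_eq_dvd_iff_nat[symmetric]) auto
      then have "N dvd t - s"
        using assms by (simp add: coprime_dvd_mult_right_iff coprime_commute flip: diff_mult_distrib2)
      then show False using st by (auto dest: dvd_imp_le)
    qed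
  qed auto
  have im: "(\<lambda>t. m * t mod N) ` {..<N} = {..<N}"
    using inj assms by (intro card_subset_eq) (auto simp: card_image)
  have "card {s. s < g * N \<and> R (m * s mod N)} = (\<Sum>s<g * N. ?f s)"
    by (simp add: Int_def of_bool_def flip: sum.inter_filter)
  also have "\<dots> = (\<Sum>q<g. \<Sum>s=q * N..<q * N + N. ?f s)" by (rule sum.nat_group[symmetric])
  also have "\<dots> = (\<Sum>q<g. \<Sum>t<N. ?f t)"
  proof (rule sum.cong)
    fix q
    have "(\<Sum>s=q * N..<q * N + N. ?f s) = (\<Sum>t=0..<N. ?f (t + q * N))"
      using sum.shift_bounds_nat_ivl[of ?f 0 "q * N" N] by (simp add: add.commute)
    also have "\<dots> = (\<Sum>t<N. ?f t)"
    proof (rule sum.cong)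
      fix t
      have "m * (t + q * N) mod N = m * t mod N"
        by (metis distrib_left mod_mult_self1 mult.assoc)
      then show "?f (t + q * N) = ?f t" by simp
    qed auto
    finally show "(\<Sum>s=q * N..<q * N + N. ?f s) = (\<Sum>t<N. ?f t)" .
  qed simp
  also have "(\<Sum>t<N. ?f t) = (\<Sum>t\<in>(\<lambda>t. m * t mod N) ` {..<N}. of_bool (R t))"
    by (subst sum.reindex[OF inj]) (simp only: o_def)
  also have "\<dots> = card {t. t < N \<and> R t}"
    unfolding im by (simp add: Int_def)
  finally show ?thesis by simp
qed

lemma cos_add_nat_2pi: "cos (x + real q * (2 * pi)) = cos x"
  using cos.plus_of_nat[of x q] by (simp only: of_real_eq_id id_apply)

lemma cos_mod:
  assumes "N > 0"
  shows "cos (2 * pi * real (a mod N) / real N) = cos (2 * pi * real a / real N)"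
proof -
  have "real a = real N * real (a div N) + real (a mod N)"
    by (metis mult_div_mod_eq of_nat_add of_nat_mult)
  then have "2 * pi * real a / real N =
      2 * pi * (real N * real (a div N) + real (a mod N)) / real N" by (simp only:)
  also have "\<dots> = 2 * pi * real (a mod N) / real N + real (a div N) * (2 * pi)"
    using assms by (simp add: field_simps)
  finally show ?thesis by (simp only: cos_add_nat_2pi)
qed

text \<open>Cancelling g = gcd m n turns m / n into a reduced fraction with denominator N = n / g.
  Each of the N equally spaced angles is then hit g times, which multiplies the error 2 by
  g.\<close>

lemma card_cos_mult_Icc:
  assumes "n > 0" "c \<le> d"
  shows "\<bar>real (card {s. s < n \<and> cos (2 * pi * real (m * s) / real n) \<in> {c..d}})
    - n * measure arcsine_law {c..d}\<bar> \<le> 2 * real (gcd m n)"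
proof -
  define g N m' where "g = gcd m n" and "N = n div g" and "m' = m div g"
  have g: "g > 0" "n = g * N" "m = g * m'" using assms by (auto simp: g_def N_def m'_def)
  then have N: "N > 0" using assms by (cases N) auto
  have cop: "coprime m' N" using assms unfolding m'_def N_def g_def by (intro div_gcd_coprime) auto
  have "cos (2 * pi * real (m * s) / real n) = cos (2 * pi * real (m' * s mod N) / real N)" for s
    unfolding cos_mod[OF N] using g by (simp add: mult.assoc)
  then have "card {s. s < n \<and> cos (2 * pi * real (m * s) / real n) \<in> {c..d}} =
      card {s. s < g * N \<and> cos (2 * pi * real (m' * s mod N) / real N) \<in> {c..d}}"
    by (simp only: g)
  also have "\<dots> = g * card {t. t < N \<and> cos (2 * pi * real t / real N) \<in> {c..d}}"
    by (rule card_coprime_mult_mod[OF N cop])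
  finally have *: "real (card {s. s < n \<and> cos (2 * pi * real (m * s) / real n) \<in> {c..d}}) -
      n * measure arcsine_law {c..d} = g * (card {t. t < N \<and> cos (2 * pi * real t / real N) \<in> {c..d}}
      - N * measure arcsine_law {c..d})"
    using g(2) by (simp add: algebra_simps)
  have "\<bar>g * (card {t. t < N \<and> cos (2 * pi * real t / real N) \<in> {c..d}}
      - N * measure arcsine_law {c..d})\<bar> \<le> g * 2"
    unfolding abs_mult of_nat_mult using card_cos_Icc[OF N assms(2)] by (intro mult_mono) auto
  then show ?thesis unfolding * by (simp add: g_def)
qed

text \<open>The reflection s -> 2 h + 1 - s pairs {1..h} with {h + 1..2 h}; only 0 has no
  partner.\<close>

lemma card_reflection:
  fixes h :: nat
  assumes "\<And>s. 1 \<le> s \<Longrightarrow> s \<le> h \<Longrightarrow> P (2 * h + 1 - s) \<longleftrightarrow> P s"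
  shows "card {s. s < 2 * h + 1 \<and> P s} = of_bool (P 0) + 2 * card {s \<in> {1..h}. P s}"
proof -
  let ?T = "{s \<in> {1..h}. P s}" and ?f = "\<lambda>s. 2 * h + 1 - s"
  have split: "{s. s < 2 * h + 1 \<and> P s} = {s. s = 0 \<and> P 0} \<union> (?T \<union> ?f ` ?T)"
  proof (intro equalityI subsetI)
    fix s assume s: "s \<in> {s. s < 2 * h + 1 \<and> P s}"
    show "s \<in> {s. s = 0 \<and> P 0} \<union> (?T \<union> ?f ` ?T)"
    proof (cases "s \<le> h")
      case False
      then have "s = ?f (?f s)" "?f s \<in> {1..h}" using s by auto
      moreover have "P (?f s)" using assms[of "?f s"] calculation s by auto
      ultimately show ?thesis by blast
    qed (use s in \<open>cases "s = 0", auto\<close>)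
  qed (use assms in auto)
  have "card {s. s < 2 * h + 1 \<and> P s} = card {s::nat. s = 0 \<and> P 0} + (card ?T + card (?f ` ?T))"
  proof -
    have fin: "finite ?T" "finite (?f ` ?T)" by simp_all
    have "?T \<inter> ?f ` ?T = {}" by auto
    then have "card (?T \<union> ?f ` ?T) = card ?T + card (?f ` ?T)"
      by (rule card_Un_disjoint[OF fin])
    moreover have "{s. s = 0 \<and> P 0} \<inter> (?T \<union> ?f ` ?T) = {}" by auto
    then have "card ({s. s = 0 \<and> P 0} \<union> (?T \<union> ?f ` ?T)) =
        card {s::nat. s = 0 \<and> P 0} + card (?T \<union> ?f ` ?T)"
      using fin by (intro card_Un_disjoint) auto
    ultimately show ?thesis unfolding split by (simp only:)
  qed
  also have "card (?f ` ?T) = card ?T"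
  proof (rule card_image, rule inj_onI)
    fix s t assume "s \<in> ?T" "t \<in> ?T" and eq: "?f s = ?f t"
    then have "s \<le> 2 * h + 1" "t \<le> 2 * h + 1" by (simp_all)
    then show "s = t" using eq by (metis diff_diff_cancel)
  qed
  also have "card {s::nat. s = 0 \<and> P 0} = of_bool (P 0)" by (cases "P 0") auto
  finally show ?thesis by simp
qed

lemma card_cos_half_range:
  assumes "c \<le> d"
  shows "\<bar>real (card {s \<in> {1..h}. cos (2 * pi * real (m * s) / real (2 * h + 1)) \<in> {c..d}})
    - h * measure arcsine_law {c..d}\<bar> \<le> 2 * real (gcd m (2 * h + 1))"
proof -
  let ?n = "2 * h + 1"
  let ?P = "\<lambda>s. cos (2 * pi * real (m * s) / real ?n) \<in> {c..d}"
  have refl: "?P (?n - s) \<longleftrightarrow> ?P s" if "1 \<le> s" "s \<le> h" for s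
  proof -
    have n: "real ?n \<noteq> 0" by simp
    have "real (m * (?n - s)) = real m * (real ?n - real s)"
      using that by (simp add: of_nat_diff)
    then have "2 * pi * real (m * (?n - s)) / real ?n =
        2 * pi * (real m * (real ?n - real s)) / real ?n" by (simp only:)
    also have "\<dots> = - (2 * pi * real (m * s) / real ?n) + real m * (2 * pi)"
      using n by (simp add: field_simps del: of_nat_add)
    finally have "cos (2 * pi * real (m * (?n - s)) / real ?n) = cos (2 * pi * real (m * s) / real ?n)"
      by (simp only: cos_add_nat_2pi cos_minus)
    then show ?thesis by simp
  qed
  have "real (card {s. s < ?n \<and> ?P s}) = of_bool (?P 0) + 2 * real (card {s \<in> {1..h}. ?P s})"
    using card_reflection[where P = ?P and h = h, OF refl] by (simp only:) simp
  moreover have "\<bar>real (card {s. s < ?n \<and> ?P s}) - ?n * measure arcsine_law {c..d}\<bar> \<le> 2 * real (gcd m ?n)"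
    using card_cos_mult_Icc[OF _ assms, of ?n m] by (simp only:)
  \<comment> \<open>Removing the point 0 and one unit of main term costs at most 1, so twice the
    discrepancy is at most 2 g + 1 for g = gcd m n; g \<ge> 1 bounds this by 4 g.\<close>
  moreover have "real (gcd m ?n) \<ge> 1" by (simp add: Suc_leI)
  moreover have "0 \<le> measure arcsine_law {c..d}" "measure arcsine_law {c..d} \<le> 1"
    using prob_space.prob_le_1[OF prob_space_arcsine_law] by auto
  moreover have "?n * measure arcsine_law {c..d} = 2 * (h * measure arcsine_law {c..d}) + measure arcsine_law {c..d}"
    by (simp add: algebra_simps)
  moreover have "0 \<le> (of_bool (?P 0) :: real)" "(of_bool (?P 0) :: real) \<le> 1" by auto
  ultimately show ?thesis by linarith
qed

subsection \<open>Discrepancy of sums\<close>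

text \<open>\<open>convolution_power M j\<close> is the law of a sum of \<open>j + 1\<close> independent variables
  distributed as \<open>M\<close>.\<close>

primrec convolution_power :: "real measure \<Rightarrow> nat \<Rightarrow> real measure" where
  "convolution_power M 0 = M"
| "convolution_power M (Suc j) = (convolution_power M j \<star> M)"

lemma sets_convolution_power: "sets M = sets borel \<Longrightarrow> sets (convolution_power M j) = sets borel"
  by (cases j) auto

lemma prob_space_convolution_power:
  assumes "prob_space M" "sets M = sets borel"
  shows "prob_space (convolution_power M j)"
proof (induction j)
  case (Suc j)
  note [measurable_cong] = assms(2) sets_convolution_power[OF assms(2), of j]
  interpret M: prob_space M by fact
  interpret L: prob_space "convolution_power M j" by fact
  interpret P: pair_prob_space "convolution_power M j" M ..
  show ?case
    unfolding convolution_power.simps convolution_def by (intro P.prob_space_distr) measurable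
qed (use assms in simp)

text \<open>Conditioning on the \<open>M\<close>-distributed summand y leaves a translated interval
  for the other one, to which an interval discrepancy can be applied pointwise in y.\<close>

lemma measure_convolution_Icc:
  fixes M N :: "real measure"
  assumes "prob_space M" "prob_space N" "sets M = sets borel" "sets N = sets borel"
  shows "(\<lambda>y. measure N {c - y..d - y}) \<in> borel_measurable borel"
    and "measure (M \<star> N) {c..d} = (\<integral>y. measure N {c - y..d - y} \<partial>M)"
proof -
  interpret M: prob_space M by fact
  interpret N: prob_space N by fact
  note [measurable_cong] = assms(3,4)
  \<comment> \<open>Written as an integral of a jointly measurable indicator, the measure of the
    moving interval is measurable in y.\<close>
  have em: "emeasure N {c - y..d - y} = (\<integral>\<^sup>+a. indicator {c..d} (y + a) \<partial>N)" for y
  proof -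
    have "(\<integral>\<^sup>+a. indicator {c..d} (y + a) \<partial>N) = (\<integral>\<^sup>+a. indicator {c - y..d - y} a \<partial>N)"
      by (intro nn_integral_cong) (auto split: split_indicator)
    also have "\<dots> = emeasure N {c - y..d - y}" using assms(4) by (intro nn_integral_indicator) simp
    finally show ?thesis by simp
  qed
  have "(\<lambda>y. enn2real (\<integral>\<^sup>+a. indicator {c..d} (y + a) \<partial>N)) \<in> borel_measurable borel"
    by measurable
  then show m: "(\<lambda>y. measure N {c - y..d - y}) \<in> borel_measurable borel"
    by (simp add: measure_def em)
  have "emeasure (M \<star> N) {c..d} = (\<integral>\<^sup>+y. emeasure N {a. a + y \<in> {c..d}} \<partial>M)"
    using assms sets_eq_imp_space_eq[OF assms(3)] sets_eq_imp_space_eq[OF assms(4)]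
    by (intro convolution_emeasure) (auto simp: M.finite_measure_axioms N.finite_measure_axioms)
  also have "\<dots> = (\<integral>\<^sup>+y. ennreal (measure N {c - y..d - y}) \<partial>M)"
    by (intro nn_integral_cong)
      (auto simp: N.emeasure_eq_measure[symmetric] intro!: arg_cong[where f = "emeasure N"])
  finally show "measure (M \<star> N) {c..d} = (\<integral>y. measure N {c - y..d - y} \<partial>M)"
    using m by (subst integral_eq_nn_integral)
      (auto simp: measure_def measurable_cong_sets[OF assms(3) refl])
qed

text \<open>Discrete counterpart of conditioning on one summand: the lists are fibred over their
  heads.\<close>

lemma card_lists_Suc:
  assumes "finite X"
  shows "card {xs. set xs \<subseteq> X \<and> length xs = Suc n \<and> P xs} =
    (\<Sum>x\<in>X. card {xs. set xs \<subseteq> X \<and> length xs = n \<and> P (x # xs)})"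
proof -
  let ?S = "SIGMA x:X. {xs. set xs \<subseteq> X \<and> length xs = n \<and> P (x # xs)}"
  have "{xs. set xs \<subseteq> X \<and> length xs = Suc n \<and> P xs} = (\<lambda>(x, xs). x # xs) ` ?S"
    by (auto simp: length_Suc_conv image_iff)
  then have "card {xs. set xs \<subseteq> X \<and> length xs = Suc n \<and> P xs} = card ?S"
    by (simp only:) (rule card_image, auto simp: inj_on_def)
  also have "\<dots> = (\<Sum>x\<in>X. card {xs. set xs \<subseteq> X \<and> length xs = n \<and> P (x # xs)})"
    using assms
    by (intro card_SigmaI) (auto intro: finite_subset[OF _ finite_lists_length_eq[OF assms, of n]])
  finally show ?thesis .
qed

text \<open>The points are replaced by \<open>M\<close>-distributed variables one at a time. Every section of
  \<open>{x. x\<^sub>0 + \<dots> + x\<^sub>j \<in> {c..d}}\<close> parallel to an axis is an interval, so each replacement costs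
  at most \<open>e\<close>.\<close>

lemma discrepancy_convolution_power:
  fixes f :: "'a \<Rightarrow> real"
  assumes M: "prob_space M" "sets M = sets borel"
    and X: "finite X" "X \<noteq> {}"
    and disc: "\<And>c d. c \<le> d \<Longrightarrow>
      \<bar>real (card {x \<in> X. f x \<in> {c..d}}) / card X - measure M {c..d}\<bar> \<le> e"
    and "c \<le> d"
  shows "\<bar>real (card {xs. set xs \<subseteq> X \<and> length xs = Suc j \<and> (\<Sum>x\<leftarrow>xs. f x) \<in> {c..d}}) / real (card X) ^ Suc j
    - measure (convolution_power M j) {c..d}\<bar> \<le> (real j + 1) * e"
  using \<open>c \<le> d\<close>
proof (induction j arbitrary: c d)
  case 0
  have "{xs. set xs \<subseteq> X \<and> length xs = Suc 0 \<and> (\<Sum>x\<leftarrow>xs. f x) \<in> {c..d}} =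
      (\<lambda>x. [x]) ` {x \<in> X. f x \<in> {c..d}}"
    by (auto simp: length_Suc_conv)
  then have "card {xs. set xs \<subseteq> X \<and> length xs = Suc 0 \<and> (\<Sum>x\<leftarrow>xs. f x) \<in> {c..d}} =
      card {x \<in> X. f x \<in> {c..d}}"
    by (simp only:) (rule card_image, auto simp: inj_on_def)
  then show ?case using disc[OF 0] by simp
next
  case (Suc j)
  define L where "L = convolution_power M j"
  define Q where "Q c d = real (card {xs. set xs \<subseteq> X \<and> length xs = Suc j \<and> (\<Sum>x\<leftarrow>xs. f x) \<in> {c..d}})
    / real (card X) ^ Suc j" for c d
  let ?N = "real (card X)"
  have N: "?N > 0" using X by (simp add: card_gt_0_iff)
  have sets_L: "sets L = sets borel" unfolding L_def by (rule sets_convolution_power[OF M(2)])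
  interpret M: prob_space M by fact
  interpret L: prob_space L unfolding L_def by (rule prob_space_convolution_power[OF M])
  have IH: "\<bar>Q (c - f x) (d - f x) - measure L {c - f x..d - f x}\<bar> \<le> (real j + 1) * e" for x
    unfolding Q_def L_def using Suc.prems by (intro Suc.IH) simp
  have "real (card {xs. set xs \<subseteq> X \<and> length xs = Suc (Suc j) \<and> (\<Sum>x\<leftarrow>xs. f x) \<in> {c..d}}) /
      real (card X) ^ Suc (Suc j) = (\<Sum>x\<in>X. Q (c - f x) (d - f x)) / ?N"
  proof -
    have "(\<Sum>y\<leftarrow>x # xs. f y) \<in> {c..d} \<longleftrightarrow> (\<Sum>y\<leftarrow>xs. f y) \<in> {c - f x..d - f x}" for x xs by auto
    then have "(\<Sum>x\<in>X. Q (c - f x) (d - f x)) = (\<Sum>x\<in>X. real (card {xs. set xs \<subseteq> X \<and>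
        length xs = Suc j \<and> (\<Sum>y\<leftarrow>x # xs. f y) \<in> {c..d}}) / real (card X) ^ Suc j)"
      by (simp only: Q_def)
    also have "\<dots> = real (card {xs. set xs \<subseteq> X \<and> length xs = Suc (Suc j) \<and>
        (\<Sum>x\<leftarrow>xs. f x) \<in> {c..d}}) / real (card X) ^ Suc j"
      by (subst (2) card_lists_Suc[OF X(1)]) (simp add: sum_divide_distrib)
    finally show ?thesis by (simp add: field_simps)
  qed
  \<comment> \<open>The head x stays fixed while the induction hypothesis, at the interval
    translated by f x, replaces the other coordinates.\<close>
  moreover have "\<bar>(\<Sum>x\<in>X. Q (c - f x) (d - f x)) / ?N - (\<Sum>x\<in>X. measure L {c - f x..d - f x}) / ?N\<bar>
      \<le> (real j + 1) * e"
  proof -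
    have "\<bar>\<Sum>x\<in>X. Q (c - f x) (d - f x) - measure L {c - f x..d - f x}\<bar> \<le> (\<Sum>x\<in>X. (real j + 1) * e)"
      by (rule order_trans[OF sum_abs sum_mono[OF IH]])
    then show ?thesis
      using N by (simp add: sum_subtractf field_simps flip: diff_divide_distrib)
  qed
  \<comment> \<open>Now the head is replaced. Exchanging sum and integral turns the average of
    \<open>L\<close>-measures into the \<open>L\<close>-integral of the proportion
    \<open>h y\<close>, which \<open>disc\<close> compares with \<open>g y\<close> for each y
    separately.\<close>
  moreover have "\<bar>(\<Sum>x\<in>X. measure L {c - f x..d - f x}) / ?N
      - measure (convolution_power M (Suc j)) {c..d}\<bar> \<le> e"
  proof -
    define h where "h y = real (card {x \<in> X. f x \<in> {c - y..d - y}}) / ?N" for y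
    define g where "g y = measure M {c - y..d - y}" for y
    have h_eq: "h y = (\<Sum>x\<in>X. indicator {c - f x..d - f x} y) / ?N" for y
    proof -
      have "real (card {x \<in> X. f x \<in> {c - y..d - y}}) = (\<Sum>x\<in>X. if f x \<in> {c - y..d - y} then 1 else 0)"
        using X(1) by (simp flip: sum.inter_filter)
      also have "\<dots> = (\<Sum>x\<in>X. indicator {c - f x..d - f x} y)"
        by (intro sum.cong) (auto split: split_indicator)
      finally show ?thesis by (simp add: h_def)
    qed
    have int_ind: "integrable L (indicator {c - f x..d - f x} :: real \<Rightarrow> real)" for x
      using sets_L by (intro L.integrable_const_bound[where B = 1]) (auto split: split_indicator)
    have int_h: "integrable L h" unfolding h_eq[abs_def] using int_ind by simp
    have "(\<integral>y. h y \<partial>L) = (\<Sum>x\<in>X. measure L {c - f x..d - f x}) / ?N"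
      unfolding h_eq using int_ind sets_L by (simp add: sets_eq_imp_space_eq[OF sets_L])
    moreover have "measure (convolution_power M (Suc j)) {c..d} = (\<integral>y. g y \<partial>L)"
      unfolding g_def using measure_convolution_Icc(2)[OF L.prob_space_axioms M(1) sets_L M(2)]
      by (simp add: L_def)
    moreover have int_g: "integrable L g"
      using measure_convolution_Icc(1)[OF L.prob_space_axioms M(1) sets_L M(2)]
      by (intro L.integrable_const_bound[where B = 1])
        (auto simp: g_def[abs_def] measurable_cong_sets[OF sets_L refl])
    moreover have "\<bar>(\<integral>y. h y \<partial>L) - (\<integral>y. g y \<partial>L)\<bar> \<le> e"
    proof -
      have "\<bar>h y - g y\<bar> \<le> e" for y
        unfolding h_def g_def using Suc.prems by (intro disc) simp
      then have "(\<integral>y. \<bar>h y - g y\<bar> \<partial>L) \<le> (\<integral>y. e \<partial>L)"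
        using int_h int_g by (intro integral_mono) auto
      moreover have "\<bar>\<integral>y. h y - g y \<partial>L\<bar> \<le> (\<integral>y. \<bar>h y - g y\<bar> \<partial>L)"
        using integral_abs_bound by blast
      ultimately show ?thesis using int_h int_g by (simp add: L.prob_space)
    qed
    ultimately show ?thesis by simp
  qed
  moreover have "(real (Suc j) + 1) * e = (real j + 1) * e + e" by (simp add: algebra_simps)
  ultimately show ?case by linarith
qed

subsection \<open>The convolution density\<close>

text \<open>Nonnegative extended values let Tonelli's theorem apply without integrability
  conditions; at exceptional u the value is \<infinity> instead of the default 0.\<close>

definition arcsine_convolution_ennreal :: "nat \<Rightarrow> real \<Rightarrow> ennreal" where
  "arcsine_convolution_ennreal k u =
     (\<integral>\<^sup>+x. ennreal ((\<Prod>i\<in>{1..<k}. arcsine_density (x i)) * arcsine_density (u - (\<Sum>i\<in>{1..<k}. x i)))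
       \<partial>Pi\<^sub>M {1..<k} (\<lambda>_. lborel))"

lemma measurable_arcsine_convolution_ennreal [measurable]:
  "arcsine_convolution_ennreal k \<in> borel_measurable borel"
proof -
  interpret product_sigma_finite "\<lambda>_. lborel :: real measure" ..
  interpret finite_product_sigma_finite "\<lambda>_. lborel :: real measure" "{1..<k}" by standard simp
  show ?thesis unfolding arcsine_convolution_ennreal_def[abs_def] by measurable
qed

text \<open>Off the cube some factor of the integrand vanishes, so integrating over the whole space
  changes nothing. At exceptional u both sides are 0, since \<open>enn2real\<close> sends
  \<infinity> to 0.\<close>

lemma arcsine_convolution_eq: "arcsine_convolution k u = enn2real (arcsine_convolution_ennreal k u)"
proof -
  let ?g = "\<lambda>x. (\<Prod>i\<in>{1..<k}. arcsine_density (x i)) * arcsine_density (u - (\<Sum>i\<in>{1..<k}. x i))"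
  have "arcsine_convolution k u = (\<integral>x. ?g x \<partial>Pi\<^sub>M {1..<k} (\<lambda>_. lborel))"
    unfolding arcsine_convolution_def set_lebesgue_integral_def
  proof (rule Bochner_Integration.integral_cong)
    fix x assume x: "x \<in> space (Pi\<^sub>M {1..<k} (\<lambda>_. lborel :: real measure))"
    show "indicat_real ({1..<k} \<rightarrow>\<^sub>E {-1..1}) x *\<^sub>R ?g x = ?g x"
    proof (cases "x \<in> {1..<k} \<rightarrow>\<^sub>E {-1..1}")
      case False
      then obtain i where "i \<in> {1..<k}" "x i \<notin> {-1..1}"
        using x by (auto simp: space_PiM PiE_iff)
      then have "(\<Prod>i\<in>{1..<k}. arcsine_density (x i)) = 0"
        by (intro prod_zero) (auto simp: arcsine_density_def intro!: bexI[of _ i])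
      then show ?thesis by simp
    qed simp
  qed simp
  also have "\<dots> = enn2real (arcsine_convolution_ennreal k u)"
    unfolding arcsine_convolution_ennreal_def
    by (rule integral_eq_nn_integral) (auto simp: arcsine_density_nonneg intro!: prod_nonneg mult_nonneg_nonneg)
  finally show ?thesis .
qed

lemma arcsine_convolution_ennreal_1: "arcsine_convolution_ennreal (Suc 0) u = arcsine_density u"
  by (simp add: arcsine_convolution_ennreal_def PiM_empty nn_integral_count_space_finite)

text \<open>Tonelli for the last coordinate y, which has index k: the remaining integral is the
  k-fold convolution evaluated at u - y.\<close>

lemma arcsine_convolution_ennreal_Suc:
  assumes "k \<ge> 1"
  shows "arcsine_convolution_ennreal (Suc k) u =
    (\<integral>\<^sup>+y. arcsine_convolution_ennreal k (u - y) * arcsine_density y \<partial>lborel)"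
proof -
  interpret product_sigma_finite "\<lambda>_. lborel :: real measure" ..
  have ivl: "{1..<Suc k} = insert k {1..<k}" using assms by auto
  let ?g = "\<lambda>x. (\<Prod>i\<in>insert k {1..<k}. arcsine_density (x i)) *
      arcsine_density (u - (\<Sum>i\<in>insert k {1..<k}. x i))"
  have "arcsine_convolution_ennreal (Suc k) u =
      (\<integral>\<^sup>+x. ennreal (?g x) \<partial>Pi\<^sub>M (insert k {1..<k}) (\<lambda>_. lborel))"
    by (simp only: arcsine_convolution_ennreal_def ivl)
  also have "\<dots> = (\<integral>\<^sup>+y. \<integral>\<^sup>+x. ennreal (?g (x(k := y))) \<partial>Pi\<^sub>M {1..<k} (\<lambda>_. lborel) \<partial>lborel)"
    by (rule product_nn_integral_insert_rev) auto
  also have "\<dots> = (\<integral>\<^sup>+y. arcsine_convolution_ennreal k (u - y) * arcsine_density y \<partial>lborel)"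
  proof (rule nn_integral_cong)
    fix y
    have "?g (x(k := y)) = (\<Prod>i\<in>{1..<k}. arcsine_density (x i)) *
        arcsine_density (u - y - (\<Sum>i\<in>{1..<k}. x i)) * arcsine_density y" for x
    proof -
      have "(\<Prod>i\<in>{1..<k}. arcsine_density ((x(k := y)) i)) = (\<Prod>i\<in>{1..<k}. arcsine_density (x i))"
        "(\<Sum>i\<in>{1..<k}. (x(k := y)) i) = (\<Sum>i\<in>{1..<k}. x i)"
        by (auto intro!: prod.cong sum.cong)
      then show ?thesis by (simp add: algebra_simps)
    qed
    then show "(\<integral>\<^sup>+x. ennreal (?g (x(k := y))) \<partial>Pi\<^sub>M {1..<k} (\<lambda>_. lborel)) =
        arcsine_convolution_ennreal k (u - y) * arcsine_density y"
      by (simp only: arcsine_convolution_ennreal_def ennreal_mult''[OF arcsine_density_nonneg])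
        (rule nn_integral_multc, measurable)
  qed
  finally show ?thesis .
qed

lemma convolution_power_arcsine_law:
  "convolution_power arcsine_law j = density lborel (arcsine_convolution_ennreal (Suc j))"
proof (induction j)
  case 0
  then show ?case by (simp add: arcsine_convolution_ennreal_1)
next
  case (Suc j)
  have "finite_measure (convolution_power arcsine_law j)"
    using prob_space_convolution_power[OF prob_space_arcsine_law, of j]
    by (simp add: prob_space.finite_measure)
  then have fin: "finite_measure (density lborel (arcsine_convolution_ennreal (Suc j)))"
    by (simp only: Suc)
  have "convolution_power arcsine_law (Suc j) =
      density lborel (\<lambda>u. \<integral>\<^sup>+y. arcsine_convolution_ennreal (Suc j) (u - y) * arcsine_density y \<partial>lborel)"
    unfolding convolution_power.simps Suc
    by (rule convolution_density)
      (auto simp: fin prob_space.finite_measure[OF prob_space_arcsine_law])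
  then show ?case by (simp add: arcsine_convolution_ennreal_Suc)
qed

text \<open>The extended density has total mass 1, hence is finite almost everywhere, and passing to
  real values alters it only on a null set.\<close>

lemma set_integral_arcsine_convolution:
  "(LINT u : {c..d} | lborel. arcsine_convolution (Suc j) u) =
    measure (convolution_power arcsine_law j) {c..d}"
proof -
  let ?D = "arcsine_convolution_ennreal (Suc j)"
  interpret prob_space "density lborel ?D"
    unfolding convolution_power_arcsine_law[symmetric]
    by (rule prob_space_convolution_power[OF prob_space_arcsine_law]) simp
  have "(\<integral>\<^sup>+u. ?D u \<partial>lborel) = 1"
    using emeasure_space_1 by (simp add: emeasure_density)
  then have fin: "AE u in lborel. ?D u \<noteq> \<infinity>"
    by (intro nn_integral_PInf_AE) auto
  have "(LINT u : {c..d} | lborel. arcsine_convolution (Suc j) u) =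
      enn2real (\<integral>\<^sup>+u. ennreal (indicator {c..d} u * enn2real (?D u)) \<partial>lborel)"
    unfolding set_lebesgue_integral_def arcsine_convolution_eq real_scaleR_def
    by (rule integral_eq_nn_integral) auto
  also have "(\<integral>\<^sup>+u. ennreal (indicator {c..d} u * enn2real (?D u)) \<partial>lborel) =
      (\<integral>\<^sup>+u. ?D u * indicator {c..d} u \<partial>lborel)"
    using fin by (intro nn_integral_cong_AE) (auto elim!: eventually_mono split: split_indicator simp: less_top)
  also have "\<dots> = emeasure (density lborel ?D) {c..d}"
    by (simp add: emeasure_density)
  finally show ?thesis by (simp add: measure_def convolution_power_arcsine_law)
qed

subsection \<open>Sums over subsets\<close>

text \<open>Denominator-free form of the statement that, among the N^k lists of length k, the
  proportion without repetition is at least 1 - k^2 / N.\<close>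

lemma card_distinct_lists_ge:
  assumes "finite X" "k \<le> card X"
  shows "real (card X) ^ k * (real (card X) - real k ^ 2)
    \<le> real (card X) * card {xs. length xs = k \<and> distinct xs \<and> set xs \<subseteq> X}"
proof -
  let ?N = "card X"
  have "real ?N ^ k * (real ?N - real k ^ 2) \<le> real ?N * real (\<Prod>{?N - k + 1..?N})"
    using assms(2)
  proof (induction k)
    case (Suc k)
    have "{?N - Suc k + 1..?N} = insert (?N - k) {?N - k + 1..?N}" using Suc.prems by auto
    then have "real (\<Prod>{?N - Suc k + 1..?N}) = (real ?N - real k) * real (\<Prod>{?N - k + 1..?N})"
      using Suc.prems by (simp add: of_nat_diff)
    then have "real ?N * real (\<Prod>{?N - Suc k + 1..?N}) =
        (real ?N * real (\<Prod>{?N - k + 1..?N})) * (real ?N - real k)" by simp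
    also have "\<dots> \<ge> (real ?N ^ k * (real ?N - real k ^ 2)) * (real ?N - real k)"
      using Suc by (intro mult_right_mono) auto
    also have "(real ?N ^ k * (real ?N - real k ^ 2)) * (real ?N - real k) =
        real ?N ^ Suc k * (real ?N - real k - real k ^ 2) + real ?N ^ k * real k ^ 3"
      by (simp add: algebra_simps power2_eq_square power3_eq_cube)
    \<comment> \<open>The term with k^3 is nonnegative and is dropped; then k + k^2 \<le> (k +
      1)^2.\<close>
    also have "\<dots> \<ge> real ?N ^ Suc k * (real ?N - real (Suc k) ^ 2)"
    proof -
      have "real ?N ^ Suc k * (real ?N - real (Suc k) ^ 2) \<le>
          real ?N ^ Suc k * (real ?N - real k - real k ^ 2)"
        by (intro mult_left_mono) (auto simp: power2_eq_square algebra_simps)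
      then show ?thesis by (simp add: add_increasing2)
    qed
    finally show ?case by simp
  qed simp
  then show ?thesis
    using card_lists_distinct_length_eq[OF assms] by simp
qed

text \<open>Every k-element set has k! orderings. The factor is the same for all sets, so
  proportions among sets equal proportions among distinct lists.\<close>

lemma card_distinct_lists_set:
  assumes "finite X"
  shows "card {xs. length xs = k \<and> distinct xs \<and> set xs \<subseteq> X \<and> P (set xs)} =
    fact k * card {T. T \<subseteq> X \<and> card T = k \<and> P T}"
proof -
  let ?F = "{T. T \<subseteq> X \<and> card T = k \<and> P T}"
  have fin: "finite T" if "T \<in> ?F" for T using that assms finite_subset by blast
  have "{xs. length xs = k \<and> distinct xs \<and> set xs \<subseteq> X \<and> P (set xs)} =
      (\<Union>T\<in>?F. permutations_of_set T)"
    by (auto simp: permutations_of_set_def distinct_card)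
  then have "card {xs. length xs = k \<and> distinct xs \<and> set xs \<subseteq> X \<and> P (set xs)} =
      card (\<Union>T\<in>?F. permutations_of_set T)" by (simp only:)
  also have "\<dots> = (\<Sum>T\<in>?F. card (permutations_of_set T))"
  proof (rule card_UN_disjoint)
    show "finite ?F" using assms by simp
    show "\<forall>T\<in>?F. finite (permutations_of_set T)" by simp
    show "\<forall>T\<in>?F. \<forall>U\<in>?F. T \<noteq> U \<longrightarrow> permutations_of_set T \<inter> permutations_of_set U = {}"
      by (auto simp: permutations_of_set_def)
  qed
  also have "\<dots> = (\<Sum>T\<in>?F. fact k)" using fin by (intro sum.cong) auto
  finally show ?thesis by simp
qed

text \<open>Conditioning a uniform choice among t objects on a subset of size b changes a
  probability by at most the proportion of objects left out. Here p and q count the favourable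
  objects inside the subset and overall; p t - q b is a difference of two numbers between 0 and b (t
  - b).\<close>

lemma ratio_subset_diff:
  fixes p q t b :: real
  assumes "b > 0" "0 \<le> p" "p \<le> b" "p \<le> q" "q - p \<le> t - b" "b \<le> t"
  shows "\<bar>p / b - q / t\<bar> \<le> (t - b) / t"
proof -
  have t: "t > 0" using assms by linarith
  have "p / b - q / t = (p * t - q * b) / (b * t)" using assms(1) t by (simp add: field_simps)
  moreover have "\<bar>p * t - q * b\<bar> \<le> b * (t - b)"
  proof -
    have "p * t - q * b = p * (t - b) - (q - p) * b" by (simp add: algebra_simps)
    moreover have "0 \<le> p * (t - b)" "p * (t - b) \<le> b * (t - b)" "0 \<le> (q - p) * b"
      "(q - p) * b \<le> (t - b) * b"
      using assms by (auto intro!: mult_right_mono mult_nonneg_nonneg)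
    ultimately show ?thesis by (simp add: mult.commute abs_le_iff)
  qed
  ultimately have "\<bar>p / b - q / t\<bar> \<le> b * (t - b) / (b * t)"
    using assms(1) t by (simp only: abs_divide) (intro frac_le, auto)
  then show ?thesis using assms(1) by simp
qed

lemma discrepancy_subset_sums:
  fixes f :: "'a \<Rightarrow> real"
  assumes M: "prob_space M" "sets M = sets borel"
    and X: "finite X" "k \<ge> 1" "k \<le> card X"
    and disc: "\<And>c d. c \<le> d \<Longrightarrow>
      \<bar>real (card {x \<in> X. f x \<in> {c..d}}) / card X - measure M {c..d}\<bar> \<le> e"
    and cd: "c \<le> d"
  shows "\<bar>real (card {T. T \<subseteq> X \<and> card T = k \<and> (\<Sum>x\<in>T. f x) \<in> {c..d}}) / card {T. T \<subseteq> X \<and> card T = k}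
    - measure (convolution_power M (k - 1)) {c..d}\<bar> \<le> real k ^ 2 / card X + k * e"
proof -
  define N where "N = card X"
  have N: "N > 0" using X by (simp add: N_def)
  let ?All = "{xs. set xs \<subseteq> X \<and> length xs = k}"
  let ?D = "{xs. length xs = k \<and> distinct xs \<and> set xs \<subseteq> X}"
  let ?A = "{xs. set xs \<subseteq> X \<and> length xs = k \<and> (\<Sum>x\<leftarrow>xs. f x) \<in> {c..d}}"
  let ?AD = "{xs. length xs = k \<and> distinct xs \<and> set xs \<subseteq> X \<and> (\<Sum>x\<in>set xs. f x) \<in> {c..d}}"
  have fin: "finite ?All" using X(1) by (rule finite_lists_length_eq)
  have all: "card ?All = N ^ k" unfolding N_def using X(1) by (rule card_lists_length_eq)
  have AD_sub: "?AD \<subseteq> ?A" by (auto simp: sum_list_distinct_conv_sum_set)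
  have finA: "finite ?A" by (rule finite_subset[OF _ fin]) auto
  have finD: "finite ?D" by (rule finite_subset[OF _ fin]) auto
  have cAD: "card ?AD = fact k * card {T. T \<subseteq> X \<and> card T = k \<and> (\<Sum>x\<in>T. f x) \<in> {c..d}}"
    by (rule card_distinct_lists_set[OF X(1)])
  have cD: "card ?D = fact k * card {T. T \<subseteq> X \<and> card T = k}"
    using card_distinct_lists_set[OF X(1), of k "\<lambda>_. True"] by (simp only: simp_thms)
  have "card {T. T \<subseteq> X \<and> card T = k} = N choose k" unfolding N_def by (rule n_subsets[OF X(1)])
  then have Dpos: "card ?D > 0" using cD X(3) by (simp add: N_def)
  \<comment> \<open>For a distinct list the list sum is the sum over its set, so a list in
    \<open>?A\<close> outside \<open>?AD\<close> must have a repetition.\<close>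
  have "card (?A - ?AD) \<le> card (?All - ?D)"
    by (intro card_mono) (use fin in \<open>auto simp: sum_list_distinct_conv_sum_set\<close>)
  moreover have "card (?A - ?AD) = card ?A - card ?AD"
    using AD_sub finA by (intro card_Diff_subset) (auto intro: finite_subset)
  moreover have "card (?All - ?D) = card ?All - card ?D"
    using finD by (intro card_Diff_subset) auto
  moreover have "card ?D \<le> card ?All" by (rule card_mono[OF fin]) auto
  moreover have "card ?AD \<le> card ?A" by (rule card_mono[OF finA AD_sub])
  moreover have "card ?AD \<le> card ?D" by (rule card_mono[OF finD]) auto
  ultimately have 1: "\<bar>real (card ?AD) / card ?D - real (card ?A) / card ?All\<bar>
      \<le> (real (card ?All) - card ?D) / card ?All"
    using Dpos by (intro ratio_subset_diff) auto
  have "real N ^ k * (real N - real k ^ 2) \<le> real N * card ?D"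
    unfolding N_def by (rule card_distinct_lists_ge[OF X(1,3)])
  then have 2: "(real (card ?All) - card ?D) / card ?All \<le> real k ^ 2 / N"
    using N unfolding all by (simp add: field_simps)
  have 3: "real (card ?AD) / card ?D =
      real (card {T. T \<subseteq> X \<and> card T = k \<and> (\<Sum>x\<in>T. f x) \<in> {c..d}}) / card {T. T \<subseteq> X \<and> card T = k}"
    unfolding cAD cD by simp
  obtain j where k: "k = Suc j" using X(2) by (cases k) auto
  have "X \<noteq> {}" using N by (auto simp: N_def)
  from discrepancy_convolution_power[OF M X(1) this disc cd, of j]
  have 4: "\<bar>real (card ?A) / card ?All - measure (convolution_power M (k - 1)) {c..d}\<bar> \<le> k * e"
    unfolding all N_def by (simp add: k add.commute)
  show ?thesis using 1 2 4 unfolding 3 N_def by linarith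
qed

subsection \<open>Symmetric sets\<close>

text \<open>n - t is the residue representing -t. The separate part \<open>Z\<close>, either empty
  or {0}, accounts for the parity of r.\<close>

definition mirror_set :: "nat \<Rightarrow> int set \<Rightarrow> nat set \<Rightarrow> int set" where
  "mirror_set n Z T = Z \<union> (int ` T \<union> (\<lambda>t. int n - int t) ` T)"

text \<open>The three parts are disjoint because elements of T lie in 1..h and their mirror images
  in h + 1..2 h. A general g serves twice: the constant 1 gives the cardinality, a character gives
  the eigenvalue.\<close>

lemma sum_mirror_set:
  assumes "Z \<subseteq> {0}" "T \<subseteq> {1..h}"
  shows "sum g (mirror_set (2 * h + 1) Z T) =
    sum g Z + (\<Sum>t\<in>T. g (int t) + g (int (2 * h + 1) - int t))"
proof -
  let ?r = "\<lambda>t. int (2 * h + 1) - int t"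
  have fin: "finite Z" "finite T" using assms finite_subset by blast+
  have range: "1 \<le> t" "t \<le> h" if "t \<in> T" for t using that assms(2) by auto
  have "int s \<noteq> ?r t" if "s \<in> T" "t \<in> T" for s t
    using range[OF that(1)] range[OF that(2)] by simp
  then have "int ` T \<inter> ?r ` T = {}" by blast
  then have "sum g (int ` T \<union> ?r ` T) = sum g (int ` T) + sum g (?r ` T)"
    using fin by (intro sum.union_disjoint) auto
  also have "sum g (int ` T) = (\<Sum>t\<in>T. g (int t))" by (simp add: sum.reindex)
  also have "sum g (?r ` T) = (\<Sum>t\<in>T. g (?r t))"
    by (subst sum.reindex) (auto simp: inj_on_def)
  finally have halves: "sum g (int ` T \<union> ?r ` T) = (\<Sum>t\<in>T. g (int t) + g (?r t))"
    by (simp only: sum.distrib)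
  have "int t \<noteq> 0" "?r t \<noteq> 0" if "t \<in> T" for t using range[OF that] by simp_all
  then have "0 \<notin> int ` T \<union> ?r ` T" by force
  moreover have "Z \<inter> A = {}" if "0 \<notin> A" for A using assms(1) that by blast
  ultimately have "Z \<inter> (int ` T \<union> ?r ` T) = {}" by blast
  then show ?thesis
    unfolding mirror_set_def using fin by (subst sum.union_disjoint) (simp_all only: finite_UnI finite_imageI halves)
qed

lemma card_mirror_set:
  assumes "Z \<subseteq> {0}" "T \<subseteq> {1..h}"
  shows "card (mirror_set (2 * h + 1) Z T) = card Z + 2 * card T"
  using sum_mirror_set[OF assms, of "\<lambda>_. 1 :: nat"] by simp

lemma symmetric_mirror_set:
  assumes "Z \<subseteq> {0}" "T \<subseteq> {1..h}"
  shows "symmetric_residue_set (2 * h + 1) (mirror_set (2 * h + 1) Z T)"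
proof -
  let ?n = "2 * h + 1" and ?r = "\<lambda>t. int (2 * h + 1) - int t"
  have range: "1 \<le> t" "t \<le> h" if "t \<in> T" for t using that assms(2) by auto
  let ?neg = "\<lambda>s. (- s) mod int ?n"
  have neg: "?neg (int t) = ?r t" "?neg (?r t) = int t" if "t \<in> T" for t
  proof -
    show "?neg (int t) = ?r t"
      using range[OF that] by (simp add: zmod_zminus1_eq_if)
    have "- ?r t mod int ?n = (int t + - 1 * int ?n) mod int ?n"
      by (rule arg_cong[where f = "\<lambda>x. x mod int ?n"]) simp
    also have "\<dots> = int t" unfolding mod_mult_self1 using range[OF that] by simp
    finally show "?neg (?r t) = int t" .
  qed
  have "?neg ` int ` T = ?r ` T" unfolding image_image by (rule image_cong[OF refl neg(1)])
  moreover have "?neg ` ?r ` T = int ` T" unfolding image_image by (rule image_cong[OF refl neg(2)])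
  moreover have "?neg ` Z = Z" using assms(1) by force
  ultimately have "?neg ` mirror_set ?n Z T = mirror_set ?n Z T"
    unfolding mirror_set_def image_Un by (simp only: Un_commute)
  moreover have "mirror_set ?n Z T \<subseteq> {0..<int ?n}"
    unfolding mirror_set_def using assms(1) range by fastforce
  ultimately show ?thesis by (simp only: symmetric_residue_set_def)
qed

text \<open>An element s above h is recovered as the mirror image of n - s, which lies in the lower
  half and, by symmetry, in S.\<close>

lemma mirror_set_lower_half:
  assumes "symmetric_residue_set (2 * h + 1) S"
  shows "mirror_set (2 * h + 1) (S \<inter> {0}) {t \<in> {1..h}. int t \<in> S} = S"
proof -
  let ?n = "2 * h + 1" and ?T = "{t \<in> {1..h}. int t \<in> S}"
  have S: "S \<subseteq> {0..<int ?n}" "(\<lambda>s. (- s) mod int ?n) ` S = S"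
    using assms by (simp_all only: symmetric_residue_set_def)
  have neg: "int ?n - s \<in> S" if "s \<in> S" "s \<noteq> 0" for s
  proof -
    have s: "0 < s" "s < int ?n" using S(1) that by force+
    have "(- s) mod int ?n = (- s + int ?n) mod int ?n" by (rule mod_add_self2[symmetric])
    also have "\<dots> = int ?n - s" using s by (subst mod_pos_pos_trivial) auto
    finally have "(- s) mod int ?n = int ?n - s" .
    moreover have "(- s) mod int ?n \<in> (\<lambda>s. (- s) mod int ?n) ` S" using that(1) by (rule imageI)
    ultimately show ?thesis unfolding S(2) by (simp only:)
  qed
  show ?thesis
  proof (intro equalityI subsetI)
    fix s assume "s \<in> mirror_set ?n (S \<inter> {0}) ?T"
    then consider "s \<in> S" | t where "t \<in> ?T" "s = int ?n - int t"
      unfolding mirror_set_def by auto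
    then show "s \<in> S" by cases (use neg in auto)
  next
    fix s assume s: "s \<in> S"
    then have b: "0 \<le> s" "s < int ?n" using S(1) by auto
    consider "s = 0" | "1 \<le> s" "s \<le> int h" | "int h < s" using b by linarith
    then show "s \<in> mirror_set ?n (S \<inter> {0}) ?T"
    proof cases
      case 2
      then have "nat s \<in> ?T" "s = int (nat s)" using s by auto
      then show ?thesis unfolding mirror_set_def by blast
    next
      case 3
      let ?t = "nat (int ?n - s)"
      have t: "int ?t = int ?n - s" using b by simp
      have "?t \<in> {1..h}" using 3 b by auto
      moreover have "int ?t \<in> S" unfolding t using neg[OF s] 3 by simp
      ultimately have "?t \<in> ?T" by simp
      moreover have "s = int ?n - int ?t" using t by simp
      ultimately show ?thesis unfolding mirror_set_def by blast
    qed (use s in \<open>simp add: mirror_set_def\<close>)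
  qed
qed

lemma bij_betw_mirror_set:
  defines "Z \<equiv> \<lambda>r::nat. if odd r then {0::int} else {}"
  shows "bij_betw (mirror_set (2 * h + 1) (Z r)) {T. T \<subseteq> {1..h} \<and> card T = r div 2}
    {S. symmetric_residue_set (2 * h + 1) S \<and> card S = r}"
proof (rule bij_betw_byWitness[where f' = "\<lambda>S. {t \<in> {1..h}. int t \<in> S}"])
  let ?n = "2 * h + 1"
  have Z: "Z r \<subseteq> {0}" "card (Z r) = r mod 2" by (auto simp: Z_def odd_iff_mod_2_eq_one)
  show "\<forall>T\<in>{T. T \<subseteq> {1..h} \<and> card T = r div 2}. {t \<in> {1..h}. int t \<in> mirror_set ?n (Z r) T} = T"
  proof
    fix T assume "T \<in> {T. T \<subseteq> {1..h} \<and> card T = r div 2}"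
    then have T: "T \<subseteq> {1..h}" by simp
    have "int t \<in> mirror_set ?n (Z r) T \<longleftrightarrow> t \<in> T" if t: "t \<in> {1..h}" for t
    proof -
      have "int t \<notin> Z r" using Z(1) t by auto
      moreover have "int t \<noteq> int ?n - int s" if "s \<in> T" for s
        using T t that by fastforce
      ultimately show ?thesis
        unfolding mirror_set_def by (simp only: Un_iff image_iff of_nat_eq_iff) blast
    qed
    then show "{t \<in> {1..h}. int t \<in> mirror_set ?n (Z r) T} = T" using T by blast
  qed
  show "mirror_set ?n (Z r) ` {T. T \<subseteq> {1..h} \<and> card T = r div 2}
      \<subseteq> {S. symmetric_residue_set ?n S \<and> card S = r}"
    using symmetric_mirror_set[OF Z(1)] card_mirror_set[OF Z(1)] Z(2) by auto
  have S: "card (S \<inter> {0}) + 2 * card {t \<in> {1..h}. int t \<in> S} = r"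
    if "symmetric_residue_set ?n S" "card S = r" for S
  proof -
    have "card (mirror_set ?n (S \<inter> {0}) {t \<in> {1..h}. int t \<in> S}) =
        card (S \<inter> {0}) + 2 * card {t \<in> {1..h}. int t \<in> S}"
      by (rule card_mirror_set) auto
    then show ?thesis unfolding mirror_set_lower_half[OF that(1)] that(2) by simp
  qed
  \<comment> \<open>The intersection with {0} has at most one element and everything else comes in
    pairs, so the parity of r decides whether 0 lies in S.\<close>
  have S0: "S \<inter> {0} = Z r" "card {t \<in> {1..h}. int t \<in> S} = r div 2"
    if "symmetric_residue_set ?n S" "card S = r" for S
  proof -
    show "S \<inter> {0} = Z r"
      using S[OF that] by (cases "0 \<in> S") (auto simp: Z_def)
    then show "card {t \<in> {1..h}. int t \<in> S} = r div 2"
      using S[OF that] Z(2) by simp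
  qed
  show "\<forall>S\<in>{S. symmetric_residue_set ?n S \<and> card S = r}.
      mirror_set ?n (Z r) {t \<in> {1..h}. int t \<in> S} = S"
  proof
    fix S assume "S \<in> {S. symmetric_residue_set ?n S \<and> card S = r}"
    then have "symmetric_residue_set ?n S" "card S = r" by auto
    then show "mirror_set ?n (Z r) {t \<in> {1..h}. int t \<in> S} = S"
      using mirror_set_lower_half[of h S] S0(1)[of S] by (simp only:)
  qed
  show "(\<lambda>S. {t \<in> {1..h}. int t \<in> S}) ` {S. symmetric_residue_set ?n S \<and> card S = r}
      \<subseteq> {T. T \<subseteq> {1..h} \<and> card T = r div 2}"
    using S0(2) by auto
qed

lemma cayley_eigenvalue_mirror_set:
  assumes "Z \<subseteq> {0}" "T \<subseteq> {1..h}"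
  shows "cayley_eigenvalue (2 * h + 1) (mirror_set (2 * h + 1) Z T) m =
    of_real (card Z + 2 * (\<Sum>t\<in>T. cos (2 * pi * real (m * t) / real (2 * h + 1))))"
proof -
  let ?n = "2 * h + 1"
  let ?g = "\<lambda>s::int. exp (2 * of_real pi * \<i> * of_nat m * of_int s / of_nat ?n) :: complex"
  let ?\<theta> = "\<lambda>t. 2 * pi * real (m * t) / real ?n"
  have "?g (int t) + ?g (int ?n - int t) = of_real (2 * cos (?\<theta> t))" if "t \<in> T" for t
  proof -
    have t: "1 \<le> t" "t \<le> h" using that assms(2) by auto
    then have "int ?n - int t = (- int t) mod int ?n"
      by (simp add: zmod_zminus1_eq_if)
    then have "?g (int ?n - int t) = ?g (- int t)"
      by (simp only: character_mod[of ?n m "- int t"])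
    moreover have "?g (int t) = cis (?\<theta> t)" "?g (- int t) = cis (- ?\<theta> t)"
      by (simp_all add: cis_conv_exp mult_ac)
    ultimately show ?thesis
      by (simp only:) (simp add: complex_eq_iff)
  qed
  then have "(\<Sum>t\<in>T. ?g (int t) + ?g (int ?n - int t)) = (\<Sum>t\<in>T. of_real (2 * cos (?\<theta> t)))"
    by (rule sum.cong[OF refl])
  moreover have "sum ?g Z = of_nat (card Z)"
  proof -
    have "Z = {} \<or> Z = {0}" using assms(1) by (simp only: subset_singleton_iff)
    then show ?thesis by (elim disjE) simp_all
  qed
  ultimately have "cayley_eigenvalue ?n (mirror_set ?n Z T) m =
      of_nat (card Z) + (\<Sum>t\<in>T. of_real (2 * cos (?\<theta> t)))"
    unfolding cayley_eigenvalue_def by (simp only: sum_mirror_set[OF assms])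
  also have "\<dots> = of_real (real (card Z) + (\<Sum>t\<in>T. 2 * cos (?\<theta> t)))"
    by (simp only: of_real_add of_real_sum of_real_of_nat_eq)
  finally show ?thesis by (simp only: sum_distrib_left)
qed

subsection \<open>Counting eigenvalues\<close>

text \<open>A general predicate lets the same count give the numerator, with the eigenvalue
  condition, and the denominator, with \<open>True\<close>.\<close>

lemma card_cayley_pairs_filter:
  assumes P: "\<And>T m. T \<subseteq> {1..h} \<Longrightarrow> card T = r div 2 \<Longrightarrow>
    P (mirror_set (2 * h + 1) (if odd r then {0} else {}) T) m \<longleftrightarrow> Q T m"
  shows "card {(S, m) \<in> cayley_pairs r (2 * h + 1). P S m} =
    (\<Sum>m<2 * h + 1. card {T. T \<subseteq> {1..h} \<and> card T = r div 2 \<and> Q T m})"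
proof -
  let ?n = "2 * h + 1" and ?f = "mirror_set (2 * h + 1) (if odd r then {0} else {})"
  let ?S = "{S. symmetric_residue_set ?n S \<and> card S = r}"
  let ?T = "{T. T \<subseteq> {1..h} \<and> card T = r div 2}"
  have bij: "bij_betw ?f ?T ?S" by (rule bij_betw_mirror_set)
  have fin: "finite ?T" by simp
  then have finS: "finite ?S" using bij bij_betw_finite by blast
  have "card {S \<in> ?S. P S m} = card {T. T \<subseteq> {1..h} \<and> card T = r div 2 \<and> Q T m}" for m
  proof -
    have "{S \<in> f ` A. P S m} = f ` {T \<in> A. P (f T) m}" for f :: "nat set \<Rightarrow> int set" and A
      by auto
    then have "{S \<in> ?S. P S m} = ?f ` {T \<in> ?T. P (?f T) m}"
      unfolding bij_betw_imp_surj_on[OF bij, symmetric] .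
    then have "card {S \<in> ?S. P S m} = card (?f ` {T \<in> ?T. P (?f T) m})" by (rule arg_cong)
    also have "\<dots> = card {T \<in> ?T. P (?f T) m}"
      by (rule card_image, rule inj_on_subset[OF bij_betw_imp_inj_on[OF bij]]) auto
    also have "{T \<in> ?T. P (?f T) m} = {T. T \<subseteq> {1..h} \<and> card T = r div 2 \<and> Q T m}"
      using P by (intro Collect_cong) auto
    finally show ?thesis .
  qed
  moreover have "card {(S, m) \<in> cayley_pairs r ?n. P S m} = (\<Sum>m<?n. card {S \<in> ?S. P S m})"
  proof -
    have "{(S, m) \<in> cayley_pairs r ?n. P S m} = (\<lambda>(m, S). (S, m)) ` (SIGMA m:{..<?n}. {S \<in> ?S. P S m})"
      by (auto simp: cayley_pairs_def image_iff)
    then have "card {(S, m) \<in> cayley_pairs r ?n. P S m} = card (SIGMA m:{..<?n}. {S \<in> ?S. P S m})"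
      by (simp only:) (rule card_image, auto simp: inj_on_def)
    also have "\<dots> = (\<Sum>m<?n. card {S \<in> ?S. P S m})"
    proof (rule card_SigmaI)
      show "\<forall>m\<in>{..<?n}. finite {S \<in> ?S. P S m}"
        by (intro ballI rev_finite_subset[OF finS] Collect_subset)
    qed simp
    finally show ?thesis .
  qed
  ultimately show ?thesis by simp
qed

text \<open>The eigenvalue is 2 s for even r and 1 + 2 s for odd r, s being the cosine sum;
  inverting this affine map produces c and d.\<close>

lemma eigenvalue_mem_iff:
  assumes "T \<subseteq> {1..h}"
    and "c = (if even r then a / 2 else (a - 1) / 2)" "d = (if even r then b / 2 else (b - 1) / 2)"
  shows "cayley_eigenvalue (2 * h + 1) (mirror_set (2 * h + 1) (if odd r then {0} else {}) T) m
      \<in> complex_of_real ` {a..b} \<longleftrightarrow>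
    (\<Sum>t\<in>T. cos (2 * pi * real (m * t) / real (2 * h + 1))) \<in> {c..d}"
proof -
  let ?Z = "if odd r then {0 :: int} else {}"
  define s where "s = (\<Sum>t\<in>T. cos (2 * pi * real (m * t) / real (2 * h + 1)))"
  have eig: "cayley_eigenvalue (2 * h + 1) (mirror_set (2 * h + 1) ?Z T) m = of_real (card ?Z + 2 * s)"
    unfolding s_def by (rule cayley_eigenvalue_mirror_set[OF _ assms(1)]) auto
  have "complex_of_real x \<in> complex_of_real ` A \<longleftrightarrow> x \<in> A" for x A by auto
  then have "complex_of_real (card ?Z + 2 * s) \<in> complex_of_real ` {a..b} \<longleftrightarrow> card ?Z + 2 * s \<in> {a..b}"
    by (simp only:)
  also have "\<dots> \<longleftrightarrow> s \<in> {c..d}" using assms(2,3) by (cases "even r") auto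
  finally show ?thesis unfolding eig s_def .
qed

text \<open>The number of subsets T does not depend on m, so the proportion over all pairs is the
  plain average over m of the proportions for fixed m, and the errors can be averaged as
  well.\<close>

lemma cayley_pairs_discrepancy:
  fixes a b c d :: real
  assumes k: "k = r div 2" "1 \<le> k" "k \<le> h" and "a \<le> b"
    and c: "c = (if even r then a / 2 else (a - 1) / 2)"
    and d: "d = (if even r then b / 2 else (b - 1) / 2)"
  shows "\<bar>real (card {(S, m) \<in> cayley_pairs r (2 * h + 1).
              cayley_eigenvalue (2 * h + 1) S m \<in> complex_of_real ` {a..b}})
          / real (card (cayley_pairs r (2 * h + 1)))
        - (LINT u : {c..d} | lborel. arcsine_convolution k u)\<bar>
      \<le> (real k ^ 2 + 2 * real k * real (divisor_count (2 * h + 1))) / real h"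
proof -
  let ?n = "2 * h + 1"
  let ?f = "\<lambda>m t. cos (2 * pi * real (m * t) / real ?n)"
  let ?num = "\<lambda>m. card {T. T \<subseteq> {1..h} \<and> card T = k \<and> (\<Sum>t\<in>T. ?f m t) \<in> {c..d}}"
  let ?den = "card {T. T \<subseteq> {1..h} \<and> card T = k}"
  define I where "I = measure (convolution_power arcsine_law (k - 1)) {c..d}"
  have h: "h > 0" using k by simp
  have cd: "c \<le> d" using c d \<open>a \<le> b\<close> by auto
  have num: "card {(S, m) \<in> cayley_pairs r ?n. cayley_eigenvalue ?n S m \<in> complex_of_real ` {a..b}}
      = (\<Sum>m<?n. ?num m)"
    unfolding k(1) by (rule card_cayley_pairs_filter) (rule eigenvalue_mem_iff[OF _ c d])
  have "card {(S, m) \<in> cayley_pairs r ?n. True} =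
      (\<Sum>m<?n. card {T. T \<subseteq> {1..h} \<and> card T = r div 2 \<and> True})"
    by (rule card_cayley_pairs_filter) simp
  then have den: "card (cayley_pairs r ?n) = ?n * ?den"
    unfolding k(1) by (simp only: simp_thms case_prod_eta) simp
  have main: "\<bar>real (?num m) / ?den - I\<bar> \<le> real k ^ 2 / h + k * (2 * real (gcd m ?n) / h)" for m
  proof -
    have "\<bar>real (card {t \<in> {1..h}. ?f m t \<in> {x..y}}) / card {1..h} - measure arcsine_law {x..y}\<bar>
        \<le> 2 * real (gcd m ?n) / h" if "x \<le> y" for x y
    proof -
      have "real (card {t \<in> {1..h}. ?f m t \<in> {x..y}}) / card {1..h} - measure arcsine_law {x..y} =
          (card {t \<in> {1..h}. ?f m t \<in> {x..y}} - h * measure arcsine_law {x..y}) / h"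
        using h by (simp add: field_simps)
      then show ?thesis
        using card_cos_half_range[OF that, of h m] h by (simp only: abs_divide) (simp add: divide_right_mono)
    qed
    from discrepancy_subset_sums[OF prob_space_arcsine_law _ _ k(2) _ this cd]
    show ?thesis using k(3) unfolding I_def by simp
  qed
  define n where "n = ?n"
  have n: "n > 0" by (simp add: n_def)
  have "real (card {(S, m) \<in> cayley_pairs r ?n. cayley_eigenvalue ?n S m \<in> complex_of_real ` {a..b}})
      / real (card (cayley_pairs r ?n)) - I = real (\<Sum>m<n. ?num m) / (n * real ?den) - I"
    unfolding num den n_def of_nat_mult ..
  also have "\<dots> = (\<Sum>m<n. real (?num m) / ?den - I) / n"
    using n by (simp only: sum_subtractf of_nat_sum flip: sum_divide_distrib)
      (simp add: diff_divide_distrib)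
  finally have "\<bar>real (card {(S, m) \<in> cayley_pairs r ?n.
        cayley_eigenvalue ?n S m \<in> complex_of_real ` {a..b}})
      / real (card (cayley_pairs r ?n)) - I\<bar> = \<bar>\<Sum>m<n. real (?num m) / ?den - I\<bar> / n"
    by simp
  also have "\<dots> \<le> (\<Sum>m<n. real k ^ 2 / h + k * (2 * real (gcd m n) / h)) / n"
    unfolding n_def by (intro divide_right_mono order_trans[OF sum_abs sum_mono[OF main]]) simp
  also have "(\<Sum>m<n. real k ^ 2 / h + k * (2 * real (gcd m n) / h)) =
      n * (real k ^ 2 / h) + 2 * k / h * real (\<Sum>m<n. gcd m n)"
    by (simp add: sum.distrib sum_distrib_left sum_divide_distrib mult_ac)
  also have "\<dots> / n \<le> (n * (real k ^ 2 / h) + 2 * k / h * real (n * divisor_count n)) / n"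
    using sum_gcd_le[OF n] by (intro divide_right_mono add_left_mono mult_left_mono of_nat_mono) auto
  also have "\<dots> = (real k ^ 2 + 2 * real k * real (divisor_count n)) / real h"
    using h n by (simp add: field_simps)
  also have "I = (LINT u : {c..d} | lborel. arcsine_convolution k u)"
    using set_integral_arcsine_convolution[of c d "k - 1"] k(2) by (simp add: I_def)
  finally show ?thesis unfolding n_def .
qed

theorem theorem1p1:
  fixes r k :: nat and \<epsilon> :: real
  assumes "r \<ge> 2" and "k = r div 2" and "\<epsilon> > 0"
  shows "\<exists>C::real. C > 0 \<and>
    (\<forall>(a::real) (b::real) (c::real) (d::real) (n::nat).
       - real r \<le> a \<longrightarrow> a \<le> b \<longrightarrow> b \<le> real r \<longrightarrow>
       odd n \<longrightarrow> n \<ge> 2 * k + 1 \<longrightarrow>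
       c = (if even r then a / 2 else (a - 1) / 2) \<longrightarrow>
       d = (if even r then b / 2 else (b - 1) / 2) \<longrightarrow>
       \<bar>real (card {(S, m) \<in> cayley_pairs r n.
                cayley_eigenvalue n S m \<in> complex_of_real ` {a..b}})
          / real (card (cayley_pairs r n))
        - (LINT u : {c..d} | lborel. arcsine_convolution k u)\<bar>
       \<le> C * real n powr (- 1 + \<epsilon>))"
proof -
  have k: "1 \<le> k" using assms(1,2) by simp
  obtain B where B: "B > 0" "\<And>n. n > 0 \<Longrightarrow> real (divisor_count n) \<le> B * real n powr \<epsilon>"
    using divisor_count_bound[OF assms(3)] by blast
  \<comment> \<open>As the number of divisors is at least 1, it can be inserted as a factor of k^2,
    and \<open>K\<close> then collects both error terms.\<close>
  define K where "K = real k ^ 2 + 2 * real k"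
  have K: "K > 0" using k by (simp add: K_def add_pos_pos)
  show ?thesis
  proof (intro exI[of _ "3 * K * B"] conjI allI impI)
    show "3 * K * B > 0" using K B by simp
    fix a b c d :: real and n :: nat
    assume ab: "a \<le> b" and n: "odd n" "n \<ge> 2 * k + 1"
      and c: "c = (if even r then a / 2 else (a - 1) / 2)"
      and d: "d = (if even r then b / 2 else (b - 1) / 2)"
    obtain h where h: "n = 2 * h + 1" using n(1) by (rule oddE)
    then have kh: "k \<le> h" "h \<ge> 1" using n(2) k by auto
    let ?\<tau> = "real (divisor_count n)"
    have "?\<tau> \<ge> 1" using divisor_count_pos[of n] h by simp
    then have "real k ^ 2 * 1 \<le> real k ^ 2 * ?\<tau>" by (intro mult_left_mono) auto
    then have "real k ^ 2 + 2 * real k * ?\<tau> \<le> K * ?\<tau>"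
      by (simp add: K_def algebra_simps)
    then have "(real k ^ 2 + 2 * real k * ?\<tau>) / h \<le> K * ?\<tau> / h"
      by (rule divide_right_mono) simp
    \<comment> \<open>The 3 in the constant arises here: n = 2 h + 1 \<le> 3 h because h \<ge>
      1.\<close>
    also have "\<dots> \<le> K * ?\<tau> / (n / 3)"
      using K kh h by (intro divide_left_mono) auto
    also have "\<dots> \<le> K * (B * real n powr \<epsilon>) / (n / 3)"
      using K B(2)[of n] h by (intro divide_right_mono mult_left_mono) auto
    also have "\<dots> = 3 * K * B * real n powr (- 1 + \<epsilon>)"
    proof -
      have "real n powr (- 1 + \<epsilon>) = real n powr \<epsilon> / real n"
        unfolding powr_add powr_minus by (simp add: field_simps)
      then show ?thesis by (simp only:) (simp add: mult_ac)
    qed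
    finally have "(real k ^ 2 + 2 * real k * ?\<tau>) / h \<le> 3 * K * B * real n powr (- 1 + \<epsilon>)" .
    with cayley_pairs_discrepancy[OF assms(2) k kh(1) ab c d]
    show "\<bar>real (card {(S, m) \<in> cayley_pairs r n.
                cayley_eigenvalue n S m \<in> complex_of_real ` {a..b}})
          / real (card (cayley_pairs r n))
        - (LINT u : {c..d} | lborel. arcsine_convolution k u)\<bar>
       \<le> 3 * K * B * real n powr (- 1 + \<epsilon>)"
      unfolding h by linarith
  qed
qed

end
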